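(* Let $\mathbb G$ be a sub-Riemannian stratified Lie group, $\phi:\mathbb G\to\mathbb R$ a $C^\infty$ function and let $M=\{x\in\mathbb G:\phi(x)=0,\ \mathrm{grad}_D\phi(x)\neq0\}$, a non-horizontal hypersurface of $\mathbb G$. Let $f_1=\frac{\mathrm{grad}_D\phi}{|\mathrm{grad}_D\phi|}$. Then the mean curvature $H$ of $M$ satisfies, at the points of $M$, $$-H_{f_1}=\mathrm{div}_{\mathbb G}\left(\frac{\mathrm{grad}_D\phi}{|\mathrm{grad}_D\phi|}\right).$$
   Context: Stratified group: $\mathbb G$ is a connected, simply connected nilpotent Lie group of dimension $n$ whose Lie algebra (of left-invariant vector fields) is $\mathfrak g=\mathfrak g^1\oplus\cdots\oplus\mathfrak g^r$ with $[\mathfrak g^1,\mathfrak g^j]=\mathfrak g^{j+1}$ for $1\le j\le r-1$ and $[\mathfrak g^j,\mathfrak g^r]=0$ for all $j$. Put $d_1=\dim\mathfrak g^1$. $D\subset T\mathbb G$ is the left-invariant distribution spanned by $\mathfrak g^1$, with a left-invariant positive definite scalar product $\langle\cdot,\cdot\rangle$. Fix a basis $e_1,\dots,e_n$ of $\mathfrak g$ adapted to the stratification, with $e_1,\dots,e_{d_1}$ an orthonormal basis of $\mathfrak g^1$, and dual basis $e^1,\dots,e^n$. $\overline\nabla$ is the flat connection on $T\mathbb G$ with $\overline\nabla e_j=0$ for all $j$. A hypersurface $M$ is non-horizontal if $TM+D=T\mathbb G$ along $M$. $TM^\perp$ is the orthogonal complement of $TM\cap D$ inside $D$; then $T\mathbb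 G=TM\oplus TM^\perp$ along $M$ (in general not orthogonal), with corresponding decomposition $v=v^\top+v^\perp$. Weingarten operator: for $\xi$ a section of $TM^\perp$ and $X\in TM$, $A_\xi(X)=-(\overline\nabla_X\xi)^\top\in TM$. Mean curvature: the tensor $H:TM^\perp\to\mathbb R$ given by $H_\xi=-\operatorname{trace}A_\xi$. Horizontal gradient: $\mathrm{grad}_D\phi=\sum_{i=1}^{d_1}e_i(\phi)e_i$, and $|\mathrm{grad}_D\phi|=\sqrt{\sum_{i=1}^{d_1}e_i(\phi)^2}$. Divergence: $\mathrm{div}_{\mathbb G}X=\sum_{k=1}^ne^k(\overline\nabla_{e_k}X)$ for a vector field $X$ on $\mathbb G$.
   Formalization: The sign of the conclusion is corrected: with A_ξ(X) = −(∇_Xξ)^⊤ and H_ξ = −trace A_ξ as defined, the identity proved is H_{f_1} = div_G(grad_D φ/|grad_D φ|), not −H_{f_1}; the unit circle in R² refutes the printed sign. *)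

theory Defs
  imports "HOL-Analysis.Analysis" "HOL-Library.Function_Algebras"
begin

section \<open>Functions with values in a vector space\<close>

text \<open>Tangent vectors are functionals and vector fields are functions into tangent vectors, so the
  pointwise vector space structure makes span, independent, dim and representation of the library
  available for both.\<close>

instantiation "fun" :: (type, real_vector) real_vector
begin

definition scaleR_fun :: "real \<Rightarrow> ('a \<Rightarrow> 'b) \<Rightarrow> 'a \<Rightarrow> 'b"
  where "scaleR_fun c f = (\<lambda>x. c *\<^sub>R f x)"

instance
  by standard (auto simp: scaleR_fun_def plus_fun_def fun_eq_iff algebra_simps)

end

text \<open>Independent of the chosen basis when V is a finite-dimensional subspace and A is a linear
  map from V to V.\<close>

definition trace_on :: "'v::real_vector set \<Rightarrow> ('v \<Rightarrow> 'v) \<Rightarrow> real"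
  where "trace_on V A =
    (let B = (SOME B. independent B \<and> span B = V) in \<Sum>b\<in>B. representation B (A b) b)"


section \<open>Smooth manifolds\<close>

text \<open>The two notions below are meant for open sets S only.\<close>

primrec Ck_on :: "nat \<Rightarrow> ('a::euclidean_space \<Rightarrow> 'b::real_normed_vector) \<Rightarrow> 'a set \<Rightarrow> bool"
  where
    "Ck_on 0 f S \<longleftrightarrow> continuous_on S f"
  | "Ck_on (Suc k) f S \<longleftrightarrow>
       f differentiable_on S \<and> (\<forall>v. Ck_on k (\<lambda>x. frechet_derivative f (at x) v) S)"

definition smooth_on :: "'a::euclidean_space set \<Rightarrow> ('a \<Rightarrow> 'b::real_normed_vector) \<Rightarrow> bool"
  where "smooth_on S f \<longleftrightarrow> (\<forall>k. Ck_on k f S)"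

text \<open>A chart is a pair of its domain and its coordinate map. The atlas need not be maximal.
  Hausdorff and second countable are imposed by the type classes of the points.\<close>

type_synonym ('g, 'e) chart = "'g set \<times> ('g \<Rightarrow> 'e)"

definition smooth_atlas ::
  "('g::{t2_space,second_countable_topology}, 'e::euclidean_space) chart set \<Rightarrow> bool"
  where "smooth_atlas A \<longleftrightarrow>
    (\<Union>(U, x)\<in>A. U) = UNIV \<and>
    (\<forall>(U, x)\<in>A. open U \<and> open (x ` U) \<and> homeomorphism U (x ` U) x (inv_into U x)) \<and>
    (\<forall>(U, x)\<in>A. \<forall>(V, y)\<in>A. smooth_on (x ` (U \<inter> V)) (y \<circ> inv_into U x))"

definition prod_atlas ::
  "('g, 'e) chart set \<Rightarrow> ('h, 'f) chart set \<Rightarrow> ('g \<times> 'h, 'e \<times> 'f) chart set"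
  where "prod_atlas A B = {(U \<times> V, map_prod x y) | U x V y. (U, x) \<in> A \<and> (V, y) \<in> B}"

definition smooth_map ::
  "('g::topological_space, 'e::euclidean_space) chart set \<Rightarrow>
   ('h::topological_space, 'f::euclidean_space) chart set \<Rightarrow> ('g \<Rightarrow> 'h) \<Rightarrow> bool"
  where "smooth_map A B F \<longleftrightarrow> continuous_on UNIV F \<and>
    (\<forall>(U, x)\<in>A. \<forall>(V, y)\<in>B. smooth_on (x ` (U \<inter> F -` V)) (y \<circ> F \<circ> inv_into U x))"

definition smooth_fun_on ::
  "('g, 'e::euclidean_space) chart set \<Rightarrow> 'g set \<Rightarrow> ('g \<Rightarrow> real) \<Rightarrow> bool"
  where "smooth_fun_on A W f \<longleftrightarrow> (\<forall>(U, x)\<in>A. smooth_on (x ` (U \<inter> W)) (f \<circ> inv_into U x))"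

definition smooth_near ::
  "('g::topological_space, 'e::euclidean_space) chart set \<Rightarrow> 'g \<Rightarrow> ('g \<Rightarrow> real) \<Rightarrow> bool"
  where "smooth_near A p f \<longleftrightarrow> (\<exists>W. open W \<and> p \<in> W \<and> smooth_fun_on A W f)"


section \<open>Tangent vectors and vector fields\<close>

text \<open>A tangent vector at p is the velocity of a curve through p, represented by its action on the
  functions that are smooth near p. All other functions are sent to 0, so that equality of
  functionals is equality of tangent vectors.\<close>

type_synonym 'g tvec = "('g \<Rightarrow> real) \<Rightarrow> real"

type_synonym 'g vfield = "'g \<Rightarrow> 'g tvec"

definition curve_at ::
  "('g::topological_space, 'e::euclidean_space) chart set \<Rightarrow> 'g \<Rightarrow> (real \<Rightarrow> 'g) \<Rightarrow> bool"
  where "curve_at A p c \<longleftrightarrow> c 0 = p \<and> isCont c 0 \<and>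
    (\<forall>(U, x)\<in>A. p \<in> U \<longrightarrow> (x \<circ> c) differentiable (at 0))"

definition velocity ::
  "('g::topological_space, 'e::euclidean_space) chart set \<Rightarrow> 'g \<Rightarrow> (real \<Rightarrow> 'g) \<Rightarrow> 'g tvec"
  where "velocity A p c = (\<lambda>f. if smooth_near A p f then deriv (f \<circ> c) 0 else 0)"

text \<open>The tangent space at p of a submanifold S; S = UNIV gives the tangent space of the
  ambient manifold.\<close>

definition tangent_space ::
  "('g::topological_space, 'e::euclidean_space) chart set \<Rightarrow> 'g set \<Rightarrow> 'g \<Rightarrow> 'g tvec set"
  where "tangent_space A S p = {velocity A p c | c. curve_at A p c \<and> range c \<subseteq> S}"

definition pushforward ::
  "('g::topological_space, 'e::euclidean_space) chart set \<Rightarrow> ('g \<Rightarrow> 'g) \<Rightarrow> 'g \<Rightarrow> 'g tvec \<Rightarrow> 'g tvec"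
  where "pushforward A F p v = (\<lambda>f. if smooth_near A (F p) f then v (f \<circ> F) else 0)"

definition smooth_vfield ::
  "('g::topological_space, 'e::euclidean_space) chart set \<Rightarrow> 'g vfield \<Rightarrow> bool"
  where "smooth_vfield A X \<longleftrightarrow> (\<forall>p. X p \<in> tangent_space A UNIV p) \<and>
    (\<forall>W f. open W \<and> smooth_fun_on A W f \<longrightarrow> smooth_fun_on A W (\<lambda>q. X q f))"

definition lie_bracket ::
  "('g::topological_space, 'e::euclidean_space) chart set \<Rightarrow> 'g vfield \<Rightarrow> 'g vfield \<Rightarrow> 'g vfield"
  where "lie_bracket A X Y = (\<lambda>p f.
    if smooth_near A p f then X p (\<lambda>q. Y q f) - Y p (\<lambda>q. X q f) else 0)"


section \<open>Sub-Riemannian stratified groups\<close>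

definition lie_group ::
  "('g::{t2_space,second_countable_topology}, 'e::euclidean_space) chart set \<Rightarrow>
   ('g \<Rightarrow> 'g \<Rightarrow> 'g) \<Rightarrow> 'g \<Rightarrow> ('g \<Rightarrow> 'g) \<Rightarrow> bool"
  where "lie_group A mul e iv \<longleftrightarrow> smooth_atlas A \<and> group mul e iv \<and>
    smooth_map (prod_atlas A A) A (\<lambda>(a, b). mul a b) \<and> smooth_map A A iv"

primrec lower_central ::
  "('g \<Rightarrow> 'g \<Rightarrow> 'g) \<Rightarrow> 'g \<Rightarrow> ('g \<Rightarrow> 'g) \<Rightarrow> nat \<Rightarrow> 'g set"
  where
    "lower_central mul e iv 0 = UNIV"
  | "lower_central mul e iv (Suc k) =
       (\<lambda>H. e \<in> H \<and> (\<forall>a\<in>H. \<forall>b\<in>H. mul a b \<in> H) \<and> (\<forall>a\<in>H. iv a \<in> H)) hull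
         {mul (mul a b) (mul (iv a) (iv b)) | a b. b \<in> lower_central mul e iv k}"

definition nilpotent_group :: "('g \<Rightarrow> 'g \<Rightarrow> 'g) \<Rightarrow> 'g \<Rightarrow> ('g \<Rightarrow> 'g) \<Rightarrow> bool"
  where "nilpotent_group mul e iv \<longleftrightarrow> (\<exists>k. lower_central mul e iv k = {e})"

definition lie_algebra ::
  "('g::topological_space, 'e::euclidean_space) chart set \<Rightarrow> ('g \<Rightarrow> 'g \<Rightarrow> 'g) \<Rightarrow> 'g vfield set"
  where "lie_algebra A mul =
    {X. smooth_vfield A X \<and> (\<forall>a p. X (mul a p) = pushforward A (mul a) p (X p))}"

text \<open>V 1, ..., V r are the strata; the values of V outside this range are irrelevant.\<close>

definition stratification ::
  "('g::topological_space, 'e::euclidean_space) chart set \<Rightarrow> ('g \<Rightarrow> 'g \<Rightarrow> 'g) \<Rightarrow>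
   nat \<Rightarrow> (nat \<Rightarrow> 'g vfield set) \<Rightarrow> bool"
  where "stratification A mul r V \<longleftrightarrow> 1 \<le> r \<and>
    (\<forall>j\<in>{1..r}. subspace (V j) \<and> V j \<subseteq> lie_algebra A mul) \<and>
    (\<forall>X\<in>lie_algebra A mul. \<exists>!Y. Y \<in> (\<Pi>\<^sub>E j\<in>{1..r}. V j) \<and> X = (\<Sum>j=1..r. Y j)) \<and>
    (\<forall>j\<in>{1..<r}. span {lie_bracket A X Y | X Y. X \<in> V 1 \<and> Y \<in> V j} = V (Suc j)) \<and>
    (\<forall>j\<in>{1..r}. \<forall>X\<in>V j. \<forall>Y\<in>V r. lie_bracket A X Y = 0)"

definition stratified_group ::
  "('g::{t2_space,second_countable_topology}, 'e::euclidean_space) chart set \<Rightarrow>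
   ('g \<Rightarrow> 'g \<Rightarrow> 'g) \<Rightarrow> 'g \<Rightarrow> ('g \<Rightarrow> 'g) \<Rightarrow> nat \<Rightarrow> (nat \<Rightarrow> 'g vfield set) \<Rightarrow> bool"
  where "stratified_group A mul e iv r V \<longleftrightarrow> lie_group A mul e iv \<and>
    connected (UNIV :: 'g set) \<and> simply_connected (UNIV :: 'g set) \<and>
    nilpotent_group mul e iv \<and> stratification A mul r V"

definition distribution :: "'g vfield set \<Rightarrow> 'g \<Rightarrow> 'g tvec set"
  where "distribution V1 p = span {X p | X. X \<in> V1}"

definition left_invariant_metric ::
  "('g::topological_space, 'e::euclidean_space) chart set \<Rightarrow> ('g \<Rightarrow> 'g \<Rightarrow> 'g) \<Rightarrow>
   'g vfield set \<Rightarrow> ('g \<Rightarrow> 'g tvec \<Rightarrow> 'g tvec \<Rightarrow> real) \<Rightarrow> bool"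
  where "left_invariant_metric A mul V1 h \<longleftrightarrow>
    (\<forall>p. \<forall>u\<in>distribution V1 p. \<forall>v\<in>distribution V1 p.
       h p u v = h p v u \<and>
       (\<forall>w\<in>distribution V1 p. h p (u + v) w = h p u w + h p v w) \<and>
       (\<forall>c. h p (c *\<^sub>R u) v = c * h p u v) \<and>
       (u \<noteq> 0 \<longrightarrow> h p u u > 0) \<and>
       (\<forall>a. h (mul a p) (pushforward A (mul a) p u) (pushforward A (mul a) p v) = h p u v))"

definition sub_riemannian_stratified_group ::
  "('g::{t2_space,second_countable_topology}, 'e::euclidean_space) chart set \<Rightarrow>
   ('g \<Rightarrow> 'g \<Rightarrow> 'g) \<Rightarrow> 'g \<Rightarrow> ('g \<Rightarrow> 'g) \<Rightarrow> nat \<Rightarrow> (nat \<Rightarrow> 'g vfield set) \<Rightarrow>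
   ('g \<Rightarrow> 'g tvec \<Rightarrow> 'g tvec \<Rightarrow> real) \<Rightarrow> bool"
  where "sub_riemannian_stratified_group A mul e iv r V h \<longleftrightarrow>
    stratified_group A mul e iv r V \<and> left_invariant_metric A mul (V 1) h"

text \<open>The basis is E 1, ..., E n, listed stratum by stratum.\<close>

definition adapted_basis ::
  "('g::topological_space, 'e::euclidean_space) chart set \<Rightarrow> ('g \<Rightarrow> 'g \<Rightarrow> 'g) \<Rightarrow>
   nat \<Rightarrow> (nat \<Rightarrow> 'g vfield set) \<Rightarrow> ('g \<Rightarrow> 'g tvec \<Rightarrow> 'g tvec \<Rightarrow> real) \<Rightarrow>
   (nat \<Rightarrow> 'g vfield) \<Rightarrow> bool"
  where "adapted_basis A mul r V h E \<longleftrightarrow>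
    inj_on E {1..DIM('e)} \<and> independent (E ` {1..DIM('e)}) \<and>
    span (E ` {1..DIM('e)}) = lie_algebra A mul \<and>
    (\<forall>j\<in>{1..r}. span (E ` {(\<Sum>i=1..<j. dim (V i))<..(\<Sum>i=1..j. dim (V i))}) = V j) \<and>
    (\<forall>p. \<forall>i\<in>{1..dim (V 1)}. \<forall>k\<in>{1..dim (V 1)}. h p (E i p) (E k p) = (if i = k then 1 else 0))"

definition dual_basis :: "nat \<Rightarrow> (nat \<Rightarrow> 'g vfield) \<Rightarrow> nat \<Rightarrow> 'g \<Rightarrow> 'g tvec \<Rightarrow> real"
  where "dual_basis n E k p v = representation ((\<lambda>j. E j p) ` {1..n}) v (E k p)"


section \<open>The flat connection, hypersurfaces and mean curvature\<close>

text \<open>The derivative of a section \<open>\<xi>\<close> of the tangent bundle of the group in the direction v,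
  for the flat connection with parallel frame E. The section is only used along S, and v is tangent
  to S: writing \<open>\<xi>\<close> as the sum of F k times E k along S near p, with F k smooth, the Leibniz
  rule gives the sum of v (F k) times E k p, whatever smooth extension F of the components is used.
  The case S = UNIV is the connection on vector fields of the group.\<close>

definition flat_connection ::
  "('g::topological_space, 'e::euclidean_space) chart set \<Rightarrow> (nat \<Rightarrow> 'g vfield) \<Rightarrow> 'g set \<Rightarrow>
   'g \<Rightarrow> 'g tvec \<Rightarrow> 'g vfield \<Rightarrow> 'g tvec"
  where "flat_connection A E S p v \<xi> = (THE w. \<exists>F U.
    open U \<and> p \<in> U \<and> (\<forall>k\<in>{1..DIM('e)}. smooth_fun_on A U (F k)) \<and>
    (\<forall>q\<in>U \<inter> S. \<xi> q = (\<Sum>k=1..DIM('e). F k q *\<^sub>R E k q)) \<and>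
    w = (\<Sum>k=1..DIM('e). v (F k) *\<^sub>R E k p))"

definition divergence ::
  "('g::topological_space, 'e::euclidean_space) chart set \<Rightarrow> (nat \<Rightarrow> 'g vfield) \<Rightarrow>
   'g vfield \<Rightarrow> 'g \<Rightarrow> real"
  where "divergence A E X p =
    (\<Sum>k=1..DIM('e). dual_basis DIM('e) E k p (flat_connection A E UNIV p (E k p) X))"

definition hgrad :: "nat \<Rightarrow> (nat \<Rightarrow> 'g vfield) \<Rightarrow> ('g \<Rightarrow> real) \<Rightarrow> 'g vfield"
  where "hgrad d E \<phi> p = (\<Sum>i=1..d. E i p \<phi> *\<^sub>R E i p)"

definition norm_hgrad :: "nat \<Rightarrow> (nat \<Rightarrow> 'g vfield) \<Rightarrow> ('g \<Rightarrow> real) \<Rightarrow> 'g \<Rightarrow> real"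
  where "norm_hgrad d E \<phi> p = sqrt (\<Sum>i=1..d. (E i p \<phi>)\<^sup>2)"

definition hypersurface ::
  "('g::topological_space, 'e::euclidean_space) chart set \<Rightarrow> 'g set \<Rightarrow> bool"
  where "hypersurface A M \<longleftrightarrow> (\<forall>p\<in>M. \<exists>U \<psi>. open U \<and> p \<in> U \<and> smooth_fun_on A U \<psi> \<and>
    M \<inter> U = {q\<in>U. \<psi> q = 0} \<and> (\<forall>q\<in>M \<inter> U. \<exists>v\<in>tangent_space A UNIV q. v \<psi> \<noteq> 0))"

definition non_horizontal ::
  "('g::topological_space, 'e::euclidean_space) chart set \<Rightarrow> 'g vfield set \<Rightarrow> 'g set \<Rightarrow> bool"
  where "non_horizontal A V1 M \<longleftrightarrow> (\<forall>p\<in>M.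
    {u + v | u v. u \<in> tangent_space A M p \<and> v \<in> distribution V1 p} = tangent_space A UNIV p)"

definition horizontal_normal ::
  "('g::topological_space, 'e::euclidean_space) chart set \<Rightarrow> 'g vfield set \<Rightarrow>
   ('g \<Rightarrow> 'g tvec \<Rightarrow> 'g tvec \<Rightarrow> real) \<Rightarrow> 'g set \<Rightarrow> 'g \<Rightarrow> 'g tvec set"
  where "horizontal_normal A V1 h M p = {v \<in> distribution V1 p.
    \<forall>u\<in>tangent_space A M p \<inter> distribution V1 p. h p u v = 0}"

definition tangential_part ::
  "('g::topological_space, 'e::euclidean_space) chart set \<Rightarrow> 'g vfield set \<Rightarrow>
   ('g \<Rightarrow> 'g tvec \<Rightarrow> 'g tvec \<Rightarrow> real) \<Rightarrow> 'g set \<Rightarrow> 'g \<Rightarrow> 'g tvec \<Rightarrow> 'g tvec"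
  where "tangential_part A V1 h M p v =
    (THE u. u \<in> tangent_space A M p \<and> v - u \<in> horizontal_normal A V1 h M p)"

definition weingarten ::
  "('g::topological_space, 'e::euclidean_space) chart set \<Rightarrow> 'g vfield set \<Rightarrow>
   ('g \<Rightarrow> 'g tvec \<Rightarrow> 'g tvec \<Rightarrow> real) \<Rightarrow> (nat \<Rightarrow> 'g vfield) \<Rightarrow> 'g set \<Rightarrow>
   'g vfield \<Rightarrow> 'g \<Rightarrow> 'g tvec \<Rightarrow> 'g tvec"
  where "weingarten A V1 h E M \<xi> p v =
    - tangential_part A V1 h M p (flat_connection A E M p v \<xi>)"

text \<open>Both the Weingarten operator and the mean curvature carry a minus sign, so the mean curvature
  is the trace of the map taking v to the tangential part of the derivative of \<open>\<xi>\<close>.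
  For the unit sphere in an abelian group of dimension n and its outer unit normal it is n - 1.\<close>

definition mean_curvature ::
  "('g::topological_space, 'e::euclidean_space) chart set \<Rightarrow> 'g vfield set \<Rightarrow>
   ('g \<Rightarrow> 'g tvec \<Rightarrow> 'g tvec \<Rightarrow> real) \<Rightarrow> (nat \<Rightarrow> 'g vfield) \<Rightarrow> 'g set \<Rightarrow>
   'g vfield \<Rightarrow> 'g \<Rightarrow> real"
  where "mean_curvature A V1 h E M \<xi> p =
    - trace_on (tangent_space A M p) (weingarten A V1 h E M \<xi> p)"

end

theory Submission
  imports Defs
begin

text \<open>Along M the decomposition \<open>TG = TM \<oplus> \<real> f\<^sub>1\<close> lets one compute the divergence, which is the
  trace of \<open>v \<mapsto> \<nabla>\<^sub>v f\<^sub>1\<close>, in a basis of TM completed by \<open>f\<^sub>1\<close>. Since \<open>f\<^sub>1\<close> has constant length and the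
  horizontal frame is both parallel and orthonormal, \<open>\<nabla>\<^sub>v f\<^sub>1\<close> is orthogonal to \<open>f\<^sub>1\<close>, hence tangent
  to M. So \<open>f\<^sub>1\<close> contributes nothing to the trace, and what remains is the trace over TM that defines
  the mean curvature. The tangent space of M is the kernel of \<open>d\<phi>\<close> by a pointwise implicit function
  argument that only needs the intermediate value theorem.\<close>

section \<open>Traces and bases\<close>

text \<open>A tangent space is a mere set of velocities, so two facts have to be earned: that the
  ambient one is a vector space, and that every vector killed by \<open>\<phi>\<close> is the
  velocity of a curve staying in \<open>M\<close> for all times. What helps is how little is asked
  of a curve: differentiability at time 0 alone. It may jump elsewhere, provided its deviation from
  the straight line is o(t). The connection along \<open>M\<close> is a definite description over
  all local extensions of the components; it has a value because a velocity of a curve in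
  \<open>M\<close> sees only values on \<open>M\<close>. The field \<open>f1\<close> is smooth with
  unit length on the whole open set of regular points, not only on \<open>M\<close>. The same
  component functions therefore compute the Weingarten operator and the divergence, and the unit
  length can be differentiated in directions transversal to \<open>M\<close>, in particular along
  \<open>f1\<close> itself.\<close>

text \<open>Expanding each \<open>b\<close> in \<open>C\<close> and each \<open>L c\<close> in
  \<open>B\<close> turns both traces into one double sum, up to the order of summation. This carries
  the divergence from the parallel frame to a basis adapted to \<open>M\<close>.\<close>

lemma trace_basis_change:
  fixes L :: "'v::real_vector \<Rightarrow> 'v"
  assumes L: "linear L" "\<And>v. v \<in> span B \<Longrightarrow> L v \<in> span B"
    and B: "independent B" "finite B" and C: "independent C" "finite C" and BC: "span B = span C"
  shows "(\<Sum>b\<in>B. representation B (L b) b) = (\<Sum>c\<in>C. representation C (L c) c)"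
proof -
  have inB: "L c \<in> span B" if "c \<in> C" for c
    using that BC L(2) span_base by metis
  have 1: "representation B (L b) b = (\<Sum>c\<in>C. representation C b c * representation B (L c) b)"
    if "b \<in> B" for b
  proof -
    have "b \<in> span C" using that BC span_base by metis
    then have "b = (\<Sum>c\<in>C. representation C b c *\<^sub>R c)"
      using C by (simp add: sum_representation_eq)
    then have "L b = (\<Sum>c\<in>C. representation C b c *\<^sub>R L c)"
      using L(1) by (metis (no_types, lifting) linear_sum linear_scale sum.cong)
    then have "representation B (L b) b = representation B (\<Sum>c\<in>C. representation C b c *\<^sub>R L c) b"
      by simp
    also have "\<dots> = (\<Sum>c\<in>C. representation B (representation C b c *\<^sub>R L c) b)"
      using B inB by (subst representation_sum) (auto intro: span_scale)
    also have "\<dots> = (\<Sum>c\<in>C. representation C b c * representation B (L c) b)"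
      using B inB by (intro sum.cong) (auto simp: representation_scale)
    finally show ?thesis .
  qed
  have 2: "representation C (L c) c = (\<Sum>b\<in>B. representation C b c * representation B (L c) b)"
    if "c \<in> C" for c
  proof -
    have "L c = (\<Sum>b\<in>B. representation B (L c) b *\<^sub>R b)"
      using B inB that by (simp add: sum_representation_eq)
    then have "representation C (L c) c = representation C (\<Sum>b\<in>B. representation B (L c) b *\<^sub>R b) c"
      by simp
    also have "\<dots> = (\<Sum>b\<in>B. representation C (representation B (L c) b *\<^sub>R b) c)"
      using C BC by (subst representation_sum) (auto intro: span_scale span_base)
    also have "\<dots> = (\<Sum>b\<in>B. representation C b c * representation B (L c) b)"
      using C BC by (intro sum.cong) (auto simp: representation_scale span_base mult.commute simp flip: BC)
    finally show ?thesis .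
  qed
  show ?thesis
    using 1 2 by (simp add: sum.swap[of _ C])
qed

text \<open>A vector of \<open>T\<close> outside \<open>span S\<close> could be added to
  \<open>S\<close>, giving an independent set in \<open>span T\<close> with more than
  \<open>card T\<close> elements.\<close>

lemma span_eq_of_card_le:
  fixes S T :: "'v::real_vector set"
  assumes "independent S" "S \<subseteq> span T" "finite T" "card T \<le> card S"
  shows "span S = span T"
proof -
  have "T \<subseteq> span S"
  proof (rule ccontr)
    assume "\<not> T \<subseteq> span S"
    then obtain x where x: "x \<in> T" "x \<notin> span S" by blast
    have fin: "finite S" using independent_span_bound[OF assms(3,1,2)] by simp
    have "independent (insert x S)" using x assms(1) by (simp add: independent_insertI)
    then have "card (insert x S) \<le> card T"
      using independent_span_bound[of T "insert x S"] assms(2,3) x by (simp add: span_base)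
    then show False using x fin assms(4) span_base[of x S] by (auto simp: card_insert_if split: if_splits)
  qed
  then show ?thesis using assms(2) by (intro subset_antisym span_minimal) auto
qed

lemma representation_image_sum:
  fixes e :: "'i \<Rightarrow> 'v::real_vector"
  assumes "inj_on e I" "independent (e ` I)" "finite I" "k \<in> I"
  shows "representation (e ` I) (\<Sum>j\<in>I. c j *\<^sub>R e j) (e k) = c k"
proof -
  have "representation (e ` I) (\<Sum>j\<in>I. c j *\<^sub>R e j) (e k) =
    (\<Sum>j\<in>I. representation (e ` I) (c j *\<^sub>R e j) (e k))"
    using assms by (subst representation_sum) (auto intro: span_scale span_base)
  also have "\<dots> = (\<Sum>j\<in>I. if j = k then c j else 0)"
    using assms
    by (intro sum.cong) (auto simp: representation_scale span_base representation_basis inj_on_def)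
  finally show ?thesis using assms by simp
qed

lemma inj_on_independent_sum_eq:
  fixes e :: "'i \<Rightarrow> 'v::real_vector"
  assumes "inj_on e I" "independent (e ` I)" "finite I" "k \<in> I"
    and "(\<Sum>j\<in>I. c j *\<^sub>R e j) = (\<Sum>j\<in>I. c' j *\<^sub>R e j)"
  shows "c k = c' k"
  using representation_image_sum[OF assms(1-4)] assms(5) by metis

lemma span_image_sum:
  fixes e :: "'i \<Rightarrow> 'v::real_vector"
  assumes "finite I" "v \<in> span (e ` I)"
  obtains c where "v = (\<Sum>i\<in>I. c i *\<^sub>R e i)"
proof -
  have "span (e ` I) \<subseteq> {v. \<exists>c. v = (\<Sum>i\<in>I. c i *\<^sub>R e i)}"
  proof (rule span_minimal)
    show "e ` I \<subseteq> {v. \<exists>c. v = (\<Sum>i\<in>I. c i *\<^sub>R e i)}"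
    proof clarify
      fix i assume "i \<in> I"
      then have "e i = (\<Sum>j\<in>I. (if j = i then 1 else 0) *\<^sub>R e j)"
        using assms(1) by (simp add: if_distrib[of "\<lambda>c. c *\<^sub>R _"] cong: if_cong)
      then show "\<exists>c. e i = (\<Sum>i\<in>I. c i *\<^sub>R e i)" by (intro exI[of _ "\<lambda>j. if j = i then 1 else 0"])
    qed
    show "subspace {v. \<exists>c. v = (\<Sum>i\<in>I. c i *\<^sub>R e i)}"
    proof (rule subspaceI)
      show "0 \<in> {v. \<exists>c. v = (\<Sum>i\<in>I. c i *\<^sub>R e i)}" by (auto intro!: exI[of _ "\<lambda>_. 0"])
    next
      fix x y assume "x \<in> {v. \<exists>c. v = (\<Sum>i\<in>I. c i *\<^sub>R e i)}" "y \<in> {v. \<exists>c. v = (\<Sum>i\<in>I. c i *\<^sub>R e i)}"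
      then obtain c d where "x = (\<Sum>i\<in>I. c i *\<^sub>R e i)" "y = (\<Sum>i\<in>I. d i *\<^sub>R e i)" by blast
      then have "x + y = (\<Sum>i\<in>I. (c i + d i) *\<^sub>R e i)" by (simp add: scaleR_add_left sum.distrib)
      then show "x + y \<in> {v. \<exists>c. v = (\<Sum>i\<in>I. c i *\<^sub>R e i)}" by (intro CollectI exI)
    next
      fix a x assume "x \<in> {v. \<exists>c. v = (\<Sum>i\<in>I. c i *\<^sub>R e i)}"
      then obtain c where "x = (\<Sum>i\<in>I. c i *\<^sub>R e i)" by blast
      then have "a *\<^sub>R x = (\<Sum>i\<in>I. (a * c i) *\<^sub>R e i)" by (simp add: scaleR_sum_right)
      then show "a *\<^sub>R x \<in> {v. \<exists>c. v = (\<Sum>i\<in>I. c i *\<^sub>R e i)}" by (intro CollectI exI)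
    qed
  qed
  then show ?thesis using assms that by blast
qed

lemma independent_imageI:
  fixes e :: "'i \<Rightarrow> 'v::real_vector"
  assumes "finite I" and "\<And>c. (\<Sum>i\<in>I. c i *\<^sub>R e i) = 0 \<Longrightarrow> \<forall>i\<in>I. c i = 0"
  shows "inj_on e I" "independent (e ` I)"
proof -
  show inj: "inj_on e I"
  proof (rule inj_onI, rule ccontr)
    fix i j assume ij: "i \<in> I" "j \<in> I" "e i = e j" "i \<noteq> j"
    \<comment> \<open>Coefficients 1 at \<open>i\<close> and -1 at \<open>j\<close> form a
      nontrivial relation if \<open>e i = e j\<close>; the hypothesis on coefficients thus excludes
      repeated vectors too.\<close>
    let ?c = "\<lambda>k. (if k = i then 1 else 0) - (if k = j then 1 else (0::real))"
    have "(\<Sum>k\<in>I. ?c k *\<^sub>R e k) = 0"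
      using ij assms(1)
      by (simp add: scaleR_diff_left sum_subtractf if_distrib[of "\<lambda>c. c *\<^sub>R _"] cong: if_cong)
    then have "\<forall>k\<in>I. ?c k = 0" by (rule assms(2))
    then show False using ij by auto
  qed
  show "independent (e ` I)"
  proof
    assume "dependent (e ` I)"
    then obtain u v where u: "v \<in> e ` I" "u v \<noteq> 0" "(\<Sum>v\<in>e ` I. u v *\<^sub>R v) = 0"
      using assms(1) by (auto simp: dependent_finite)
    then have "(\<Sum>i\<in>I. u (e i) *\<^sub>R e i) = 0"
      using inj by (simp add: sum.reindex)
    then show False using assms(2)[of "\<lambda>i. u (e i)"] u by auto
  qed
qed

section \<open>Evaluation of vector-valued functions\<close>

lemma fun_scaleR_apply [simp]: "(c *\<^sub>R f) x = c *\<^sub>R f x"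
  by (simp add: scaleR_fun_def)

lemma linear_eval: "linear (\<lambda>X. X p :: 'b::real_vector)"
  by (rule linearI) auto

text \<open>Serves on two levels: evaluating a vector field at a point, and a tangent vector at a
  function.\<close>

lemma fun_sum_apply: "(\<Sum>i\<in>I. f i) x = (\<Sum>i\<in>I. f i x :: 'b::real_vector)"
  using linear_sum[OF linear_eval[of x], of f I] by simp

section \<open>Smooth functions\<close>

text \<open>\<open>frechet_derivative\<close> is a choice from the relation
  \<open>has_derivative\<close>; the relations for \<open>f\<close> and \<open>g\<close> coincide,
  hence so do the choices, even where no derivative exists.\<close>

lemma frechet_derivative_cong_open:
  assumes "open S" "x \<in> S" "\<And>y. y \<in> S \<Longrightarrow> f y = g y"
  shows "frechet_derivative f (at x) = frechet_derivative g (at x)"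
proof -
  have "(f has_derivative f') (at x) \<longleftrightarrow> (g has_derivative f') (at x)" for f'
    using has_derivative_transform_within_open[of f f' x UNIV S g]
      has_derivative_transform_within_open[of g f' x UNIV S f] assms by auto
  then show ?thesis by (simp add: frechet_derivative_def)
qed

lemma differentiable_on_cong:
  assumes "\<And>y. y \<in> S \<Longrightarrow> f y = g y"
  shows "f differentiable_on S \<longleftrightarrow> g differentiable_on S"
proof -
  have "g differentiable_on S" if hyp: "f differentiable_on S" "\<And>y. y \<in> S \<Longrightarrow> f y = g y" for f g :: "'a \<Rightarrow> 'b"
    unfolding differentiable_on_def
  proof
    fix x assume "x \<in> S"
    then obtain D where "(f has_derivative D) (at x within S)"
      using hyp(1) unfolding differentiable_on_def differentiable_def by blast
    then have "(g has_derivative D) (at x within S)"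
      by (rule has_derivative_transform_within[OF _ zero_less_one \<open>x \<in> S\<close>]) (use hyp(2) in auto)
    then show "g differentiable (at x within S)" by (auto simp: differentiable_def)
  qed
  then show ?thesis using assms by metis
qed

text \<open>Differentiation rules hold only at points of \<open>S\<close>, while
  \<open>Ck_on\<close> takes functions on the whole space. This congruence lets a derivative be
  replaced by its formula on \<open>S\<close>.\<close>

lemma Ck_on_cong:
  assumes "open S" "\<And>y. y \<in> S \<Longrightarrow> f y = g y"
  shows "Ck_on k f S \<longleftrightarrow> Ck_on k g S"
  using assms
proof (induction k arbitrary: f g)
  case 0
  then show ?case by (simp cong: continuous_on_cong)
next
  case (Suc k)
  have "Ck_on k (\<lambda>x. frechet_derivative f (at x) v) S \<longleftrightarrow>
      Ck_on k (\<lambda>x. frechet_derivative g (at x) v) S" for v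
    by (rule Suc.IH[OF Suc.prems(1)]) (use frechet_derivative_cong_open Suc.prems in metis)
  then show ?case using differentiable_on_cong[of S f g] Suc.prems(2) by (simp del: all_simps)
qed

lemma Ck_on_continuous: "Ck_on k f S \<Longrightarrow> continuous_on S f"
  by (cases k) (auto intro: differentiable_imp_continuous_on)

lemma Ck_on_Suc: "Ck_on (Suc k) f S \<Longrightarrow> Ck_on k f S"
  by (induction k arbitrary: f) (auto intro: differentiable_imp_continuous_on)

lemma Ck_on_subset: "Ck_on k f S \<Longrightarrow> T \<subseteq> S \<Longrightarrow> Ck_on k f T"
  by (induction k arbitrary: f)
    (auto intro: continuous_on_subset differentiable_on_subset)

lemma smooth_on_subset: "smooth_on S f \<Longrightarrow> T \<subseteq> S \<Longrightarrow> smooth_on T f"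
  by (auto simp: smooth_on_def intro: Ck_on_subset)

lemma smooth_on_continuous: "smooth_on S f \<Longrightarrow> continuous_on S f"
  by (auto simp: smooth_on_def intro: Ck_on_continuous)

lemma smooth_on_differentiable:
  assumes "smooth_on S f" "open S" "x \<in> S"
  shows "f differentiable (at x)"
proof -
  have "Ck_on (Suc 0) f S" using assms(1) unfolding smooth_on_def by blast
  then show ?thesis using assms(2,3)
    by (simp add: differentiable_on_eq_differentiable_at)
qed

lemma Ck_on_const: "Ck_on k (\<lambda>x. c) S"
  by (induction k arbitrary: c) auto

lemma Ck_on_add:
  assumes "open S" "Ck_on k f S" "Ck_on k g S"
  shows "Ck_on k (\<lambda>x. f x + g x) S"
  using assms
proof (induction k arbitrary: f g)
  case 0
  then show ?case by (simp add: continuous_on_add)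
next
  case (Suc k)
  have D: "(f has_derivative frechet_derivative f (at x)) (at x)"
    "(g has_derivative frechet_derivative g (at x)) (at x)" if "x \<in> S" for x
    using Suc.prems that
    by (auto simp: differentiable_on_eq_differentiable_at frechet_derivative_works[THEN iffD1])
  have "Ck_on k (\<lambda>x. frechet_derivative (\<lambda>x. f x + g x) (at x) v) S" for v
  proof (subst Ck_on_cong[OF Suc.prems(1)])
    show "frechet_derivative (\<lambda>x. f x + g x) (at x) v =
        frechet_derivative f (at x) v + frechet_derivative g (at x) v" if "x \<in> S" for x
      using frechet_derivative_at[OF has_derivative_add[OF D[OF that]]] by metis
    show "Ck_on k (\<lambda>x. frechet_derivative f (at x) v + frechet_derivative g (at x) v) S"
      using Suc by simp
  qed
  then show ?case using Suc.prems by (simp add: differentiable_on_add)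
qed

lemma Ck_on_mult:
  fixes f g :: "'a::euclidean_space \<Rightarrow> real"
  assumes "open S" "Ck_on k f S" "Ck_on k g S"
  shows "Ck_on k (\<lambda>x. f x * g x) S"
  using assms
proof (induction k arbitrary: f g)
  case 0
  then show ?case by (simp add: continuous_on_mult)
next
  case (Suc k)
  have D: "(f has_derivative frechet_derivative f (at x)) (at x)"
    "(g has_derivative frechet_derivative g (at x)) (at x)" if "x \<in> S" for x
    using Suc.prems that
    by (auto simp: differentiable_on_eq_differentiable_at frechet_derivative_works[THEN iffD1])
  have "Ck_on k (\<lambda>x. frechet_derivative (\<lambda>x. f x * g x) (at x) v) S" for v
  proof (subst Ck_on_cong[OF Suc.prems(1)])
    show "frechet_derivative (\<lambda>x. f x * g x) (at x) v =
        f x * frechet_derivative g (at x) v + frechet_derivative f (at x) v * g x" if "x \<in> S" for x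
      using frechet_derivative_at[OF has_derivative_mult[OF D[OF that]]] by metis
    show "Ck_on k (\<lambda>x. f x * frechet_derivative g (at x) v + frechet_derivative f (at x) v * g x) S"
      using Suc.prems Ck_on_Suc[of k f S] Ck_on_Suc[of k g S]
      by (intro Ck_on_add Suc.IH) auto
  qed
  then show ?case using Suc.prems by simp
qed

text \<open>With \<open>a = -1/2\<close> this covers the factor 1/|grad|. Differentiation lowers the
  exponent by one, so the induction runs over all exponents at once.\<close>

lemma Ck_on_powr:
  fixes f :: "'a::euclidean_space \<Rightarrow> real"
  assumes "open S" "Ck_on k f S" "\<And>x. x \<in> S \<Longrightarrow> f x > 0"
  shows "Ck_on k (\<lambda>x. f x powr a) S"
  using assms
proof (induction k arbitrary: a)
  case 0
  then show ?case by (force intro!: continuous_intros)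
next
  case (Suc k)
  have D: "(f has_derivative frechet_derivative f (at x)) (at x)" if "x \<in> S" for x
    using Suc.prems that
    by (auto simp: differentiable_on_eq_differentiable_at frechet_derivative_works[THEN iffD1])
  have P: "((\<lambda>x. f x powr a) has_derivative
      (\<lambda>v. (a * f x powr (a - 1)) * frechet_derivative f (at x) v)) (at x)" if "x \<in> S" for x
  proof -
    have "((\<lambda>y. y powr a) has_real_derivative a * f x powr (a - 1)) (at (f x))"
      using Suc.prems(3)[OF that] by (rule has_real_derivative_powr)
    then show ?thesis
      using D[OF that] has_derivative_compose[of f _ x UNIV "\<lambda>y. y powr a"]
      by (simp add: has_field_derivative_def)
  qed
  have "Ck_on k (\<lambda>x. frechet_derivative (\<lambda>x. f x powr a) (at x) v) S" for v
  proof (subst Ck_on_cong[OF Suc.prems(1)])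
    show "frechet_derivative (\<lambda>x. f x powr a) (at x) v =
        (a * f x powr (a - 1)) * frechet_derivative f (at x) v" if "x \<in> S" for x
      using frechet_derivative_at[OF P[OF that]] by metis
    show "Ck_on k (\<lambda>x. (a * f x powr (a - 1)) * frechet_derivative f (at x) v) S"
      using Suc.prems Ck_on_Suc[of k f S] by (intro Ck_on_mult Ck_on_const Suc.IH) auto
  qed
  moreover have "(\<lambda>x. f x powr a) differentiable_on S"
    using P Suc.prems(1) by (auto simp: differentiable_on_eq_differentiable_at differentiable_def)
  ultimately show ?case by simp
qed

section \<open>Curves in level sets\<close>

text \<open>The nearest root on the line through \<open>a + t v\<close> in the transversal direction w
  is \<open>o(t)\<close> away; it need not depend continuously on t outside 0.\<close>

lemma curve_in_level_set:
  fixes g :: "'e::euclidean_space \<Rightarrow> real"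
  assumes Op: "open W" "a \<in> W" and g: "continuous_on W g" "(g has_derivative g') (at a)"
    and z: "g a = 0" "g' v = 0" "g' w \<noteq> 0"
  obtains \<gamma> :: "real \<Rightarrow> 'e" where "\<gamma> 0 = a" "(\<gamma> has_vector_derivative v) (at 0)"
    "\<And>t. \<gamma> t \<in> W \<and> g (\<gamma> t) = 0"
proof -
  interpret g': bounded_linear g' using g(2) by (rule has_derivative_bounded_linear)
  \<comment> \<open>Normalised so that a shift by \<open>s\<close> along \<open>u\<close> changes
    \<open>g\<close> by \<open>s\<close> to first order.\<close>
  define u where "u = (1 / g' w) *\<^sub>R w"
  have gu: "g' u = 1" using z by (simp add: u_def g'.scaleR)
  define R where "R t = {s. a + t *\<^sub>R v + s *\<^sub>R u \<in> W \<and> g (a + t *\<^sub>R v + s *\<^sub>R u) = 0}" for t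
  have claim: "\<exists>\<delta>>0. \<forall>t. \<bar>t\<bar> < \<delta> \<longrightarrow> (\<exists>s\<in>R t. \<bar>s\<bar> \<le> \<epsilon> * \<bar>t\<bar>)" if eps: "\<epsilon> > 0" for \<epsilon>
  proof -
    \<comment> \<open>Points with \<bar>s\<bar> \<le> \<epsilon>\<bar>t\<bar> lie within
      \<open>K * \<bar>t\<bar>\<close> of \<open>a\<close>; the summand 1 makes \<open>K\<close>
      positive. The tolerance \<epsilon>/K below then bounds the linearisation error by
      \<epsilon>\<bar>t\<bar>.\<close>
    define K where "K = norm v + \<epsilon> * norm u + 1"
    have K: "K > 0" using eps by (simp add: K_def add_nonneg_pos)
    obtain d1 where d1: "d1 > 0" "\<And>y. norm (y - a) < d1 \<Longrightarrow>
        norm (g y - g a - g' (y - a)) \<le> (\<epsilon> / K) * norm (y - a)"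
      using g(2) eps K unfolding has_derivative_at_alt by (meson divide_pos_pos)
    obtain d2 where d2: "d2 > 0" "ball a d2 \<subseteq> W"
      using Op openE by blast
    define \<delta> where "\<delta> = min d1 d2 / K"
    have "\<exists>s\<in>R t. \<bar>s\<bar> \<le> \<epsilon> * \<bar>t\<bar>" if t: "\<bar>t\<bar> < \<delta>" for t
    proof -
      let ?p = "\<lambda>s. a + t *\<^sub>R v + s *\<^sub>R u"
      have n: "norm (?p s - a) \<le> K * \<bar>t\<bar>" if "\<bar>s\<bar> \<le> \<epsilon> * \<bar>t\<bar>" for s
      proof -
        have "norm (?p s - a) \<le> \<bar>t\<bar> * norm v + \<bar>s\<bar> * norm u"
          using norm_triangle_ineq[of "t *\<^sub>R v" "s *\<^sub>R u"] by simp
        also have "\<dots> \<le> \<bar>t\<bar> * norm v + (\<epsilon> * \<bar>t\<bar>) * norm u"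
          using that by (simp add: mult_right_mono)
        also have "\<dots> \<le> K * \<bar>t\<bar>" by (simp add: K_def algebra_simps)
        finally show ?thesis .
      qed
      have Kt: "K * \<bar>t\<bar> < min d1 d2" using t K by (simp add: \<delta>_def field_simps)
      have inW: "?p s \<in> W" if "\<bar>s\<bar> \<le> \<epsilon> * \<bar>t\<bar>" for s
        using n[OF that] Kt dist_commute[of a "?p s"] dist_norm[of "?p s" a]
        by (intro subsetD[OF d2(2)]) (simp del: dist_norm)
      have est: "\<bar>g (?p s) - s\<bar> \<le> \<epsilon> * \<bar>t\<bar>" if "\<bar>s\<bar> \<le> \<epsilon> * \<bar>t\<bar>" for s
      proof -
        have "g' (?p s - a) = s" using z gu by (simp add: g'.add g'.scaleR)
        then have "\<bar>g (?p s) - s\<bar> \<le> (\<epsilon> / K) * norm (?p s - a)"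
          using d1(2)[of "?p s"] n[OF that] Kt z by simp
        also have "\<dots> \<le> (\<epsilon> / K) * (K * \<bar>t\<bar>)" using n[OF that] eps K by (intro mult_left_mono) auto
        finally show ?thesis using K by simp
      qed
      let ?e = "\<epsilon> * \<bar>t\<bar>"
      have e0: "0 \<le> ?e" using eps by simp
      \<comment> \<open>The value of \<open>g\<close> differs from \<open>s\<close> by at most
        \<open>?e\<close>, so it is nonpositive at \<open>s = -?e\<close> and nonnegative at
        \<open>s = ?e\<close>.\<close>
      have "\<exists>s. -?e \<le> s \<and> s \<le> ?e \<and> g (?p s) = 0"
      proof (rule IVT')
        show "g (?p (- ?e)) \<le> 0" "0 \<le> g (?p ?e)" using est[of "- ?e"] est[of ?e] e0
          unfolding abs_le_iff by linarith+
        show "- ?e \<le> ?e" using e0 by simp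
        show "continuous_on {- ?e..?e} (\<lambda>s. g (?p s))"
          by (rule continuous_on_compose2[OF g(1)]) (auto intro!: continuous_intros inW)
      qed
      then obtain s where "\<bar>s\<bar> \<le> ?e" "g (?p s) = 0" using abs_le_iff minus_le_iff by metis
      then show ?thesis using inW by (auto simp: R_def)
    qed
    moreover have "\<delta> > 0" using d1 d2 K by (simp add: \<delta>_def)
    ultimately show ?thesis by blast
  qed
  \<comment> \<open>One curve must serve every \<epsilon>, so a root of almost least modulus is
    chosen: it is no worse, up to t^2, than the root found for any given \<epsilon>. The slack t^2
    is o(t), and it avoids asking whether the infimum is attained.\<close>
  define m where "m t = Inf (abs ` R t)" for t
  have near: "\<exists>s. s \<in> R t \<and> \<bar>s\<bar> \<le> m t + t\<^sup>2" if "R t \<noteq> {}" "t \<noteq> 0" for t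
  proof -
    have "Inf (abs ` R t) < m t + t\<^sup>2" using that by (simp add: m_def)
    then show ?thesis
      using cInf_lessD[of "abs ` R t"] that by fastforce
  qed
  have m: "m t \<le> \<bar>s\<bar>" if "s \<in> R t" for s t
    unfolding m_def by (rule cInf_lower) (use that in \<open>auto intro: bdd_belowI[of _ 0]\<close>)
  define \<sigma> where "\<sigma> t = (SOME s. s \<in> R t \<and> \<bar>s\<bar> \<le> m t + t\<^sup>2)" for t
  have \<sigma>: "\<sigma> t \<in> R t" "\<bar>\<sigma> t\<bar> \<le> m t + t\<^sup>2" if "R t \<noteq> {}" "t \<noteq> 0" for t
    using someI_ex[OF near[OF that]] by (auto simp: \<sigma>_def)
  \<comment> \<open>Falling back to \<open>a\<close> where no root exists keeps the curve in the
    level set for all times. Near 0 roots exist, so the derivative is unaffected.\<close>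
  define \<gamma> where "\<gamma> t = (if t = 0 \<or> R t = {} then a else a + t *\<^sub>R v + \<sigma> t *\<^sub>R u)" for t
  have "((\<lambda>t. (\<gamma> t - \<gamma> 0 - t *\<^sub>R v) /\<^sub>R \<bar>t\<bar>) \<longlongrightarrow> 0) (at 0)"
  proof (rule tendstoI)
    fix e :: real assume e: "e > 0"
    \<comment> \<open>The bound \<bar>t\<bar> < \<epsilon> absorbs the slack t^2 into a second
      \<epsilon>\<bar>t\<bar>, whence the factor 2; adding 1 to the norm makes the final inequality
      strict.\<close>
    define \<epsilon> where "\<epsilon> = e / (2 * (norm u + 1))"
    have \<epsilon>: "\<epsilon> > 0" using e by (simp add: \<epsilon>_def add_nonneg_pos)
    obtain \<delta> where \<delta>: "\<delta> > 0" "\<And>t. \<bar>t\<bar> < \<delta> \<Longrightarrow> \<exists>s\<in>R t. \<bar>s\<bar> \<le> \<epsilon> * \<bar>t\<bar>"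
      using claim[OF \<epsilon>] by blast
    have "dist ((\<gamma> t - \<gamma> 0 - t *\<^sub>R v) /\<^sub>R \<bar>t\<bar>) 0 < e" if t: "t \<noteq> 0" "\<bar>t\<bar> < min \<delta> \<epsilon>" for t
    proof -
      obtain s where s: "s \<in> R t" "\<bar>s\<bar> \<le> \<epsilon> * \<bar>t\<bar>" using \<delta>(2) t by auto
      then have ne: "R t \<noteq> {}" by blast
      have "\<bar>\<sigma> t\<bar> \<le> \<epsilon> * \<bar>t\<bar> + \<bar>t\<bar> * \<bar>t\<bar>"
        using \<sigma>(2)[OF ne t(1)] m[OF s(1)] s(2) by (simp add: power2_eq_square)
      also have "\<dots> \<le> \<epsilon> * \<bar>t\<bar> + \<epsilon> * \<bar>t\<bar>" using t by (intro add_left_mono mult_right_mono) auto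
      finally have st: "\<bar>\<sigma> t\<bar> / \<bar>t\<bar> \<le> 2 * \<epsilon>" using t by (simp add: field_simps)
      have "dist ((\<gamma> t - \<gamma> 0 - t *\<^sub>R v) /\<^sub>R \<bar>t\<bar>) 0 = (\<bar>\<sigma> t\<bar> / \<bar>t\<bar>) * norm u"
        using ne t by (simp add: \<gamma>_def divide_inverse abs_mult)
      also have "\<dots> \<le> (2 * \<epsilon>) * norm u" using st by (intro mult_right_mono) auto
      also have "\<dots> < (2 * \<epsilon>) * (norm u + 1)" using \<epsilon> by simp
      also have "\<dots> = e"
        using norm_ge_zero[of u] by (simp add: \<epsilon>_def field_simps add_nonneg_eq_0_iff)
      finally show ?thesis .
    qed
    then show "\<forall>\<^sub>F t in at 0. dist ((\<gamma> t - \<gamma> 0 - t *\<^sub>R v) /\<^sub>R \<bar>t\<bar>) 0 < e"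
      using \<delta> \<epsilon> unfolding eventually_at by (intro exI[of _ "min \<delta> \<epsilon>"]) (auto simp: dist_norm)
  qed
  then have "(\<gamma> has_vector_derivative v) (at 0)"
    by (simp add: has_vector_derivative_def has_derivative_def bounded_linear_scaleR_left)
  moreover have "\<gamma> t \<in> W \<and> g (\<gamma> t) = 0" for t
    using \<sigma>(1)[of t] Op z by (auto simp: \<gamma>_def R_def)
  ultimately show ?thesis using that[of \<gamma>] by (simp add: \<gamma>_def)
qed

section \<open>Tangent spaces\<close>

lemma smooth_atlas_chartD:
  assumes "smooth_atlas A" "(U, x) \<in> A"
  shows "open U" "open (x ` U)" "inj_on x U" "continuous_on U x"
    "continuous_on (x ` U) (inv_into U x)" "homeomorphism U (x ` U) x (inv_into U x)"
proof -
  show *: "open U" "open (x ` U)" "homeomorphism U (x ` U) x (inv_into U x)"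
    using assms unfolding smooth_atlas_def by auto
  then show "inj_on x U" "continuous_on U x" "continuous_on (x ` U) (inv_into U x)"
    unfolding homeomorphism_def by (auto intro: inj_on_inverseI)
qed

lemma smooth_atlas_open_image:
  assumes "smooth_atlas A" "(U, x) \<in> A" "open W"
  shows "open (x ` (U \<inter> W))"
proof -
  note chart = smooth_atlas_chartD[OF assms(1,2)]
  have "openin (top_of_set (x ` U)) (x ` (U \<inter> W))"
    by (rule homeomorphism_imp_open_map[OF chart(6)]) (use assms in \<open>auto simp: openin_open\<close>)
  then show ?thesis using chart(2) openin_open_trans by blast
qed

lemma smooth_atlas_cover:
  assumes "smooth_atlas A"
  obtains U x where "(U, x) \<in> A" "p \<in> U"
proof -
  have "p \<in> (\<Union>(U, x)\<in>A. U)" using assms unfolding smooth_atlas_def by simp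
  then show ?thesis using that by auto
qed

text \<open>\<open>curve_at\<close> demands differentiability in every chart at the point; through
  the transition maps a single chart suffices.\<close>

lemma smooth_atlas_transition_differentiable:
  assumes "smooth_atlas A" "(U, x) \<in> A" "(V, y) \<in> A" "p \<in> U" "p \<in> V"
  shows "(y \<circ> inv_into U x) differentiable (at (x p))"
proof (rule smooth_on_differentiable)
  show "smooth_on (x ` (U \<inter> V)) (y \<circ> inv_into U x)"
    using assms(1-3) unfolding smooth_atlas_def by fastforce
  show "open (x ` (U \<inter> V))"
    using assms smooth_atlas_open_image smooth_atlas_chartD(1) by blast
qed (use assms in auto)

lemma smooth_fun_on_subset:
  assumes "smooth_fun_on A W f" "W' \<subseteq> W"
  shows "smooth_fun_on A W' f"
  using assms unfolding smooth_fun_on_def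
  by (fast intro: smooth_on_subset)

lemma smooth_fun_on_continuous:
  assumes A: "smooth_atlas A" and W: "open W" and f: "smooth_fun_on A W f"
  shows "continuous_on W f"
proof (rule continuous_at_imp_continuous_on, rule ballI)
  fix q assume q: "q \<in> W"
  obtain U x where U: "(U, x) \<in> A" "q \<in> U" using smooth_atlas_cover[OF A] .
  note chart = smooth_atlas_chartD[OF A U(1)]
  have "continuous_on (x ` (U \<inter> W)) (f \<circ> inv_into U x)"
    using f U(1) unfolding smooth_fun_on_def by (intro smooth_on_continuous) blast
  then have "continuous_on (U \<inter> W) (\<lambda>q. (f \<circ> inv_into U x) (x q))"
    by (rule continuous_on_compose2) (auto intro: continuous_on_subset[OF chart(4)])
  then have "continuous_on (U \<inter> W) f"
    by (rule continuous_on_eq) (use chart(3) in auto)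
  then show "isCont f q"
    using chart(1) W U q by (auto simp: continuous_on_eq_continuous_at open_Int)
qed

lemma smooth_near_differentiable:
  assumes "smooth_atlas A" "(U, x) \<in> A" "p \<in> U" "smooth_near A p f"
  shows "(f \<circ> inv_into U x) differentiable (at (x p))"
proof -
  obtain W where W: "open W" "p \<in> W" "smooth_fun_on A W f"
    using assms(4) unfolding smooth_near_def by blast
  show ?thesis
  proof (rule smooth_on_differentiable)
    show "smooth_on (x ` (U \<inter> W)) (f \<circ> inv_into U x)"
      using W assms(2) unfolding smooth_fun_on_def by auto
    show "open (x ` (U \<inter> W))" using smooth_atlas_open_image assms W by blast
  qed (use assms W in auto)
qed

text \<open>The tangent vector at p with components w in the chart \<open>(U, x)\<close>.\<close>

definition chart_tvec ::
  "('g::topological_space, 'e::euclidean_space) chart set \<Rightarrow> 'g set \<Rightarrow> ('g \<Rightarrow> 'e) \<Rightarrow> 'g \<Rightarrow> 'e \<Rightarrow> 'g tvec"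
  where "chart_tvec A U x p w = (\<lambda>f. if smooth_near A p f
    then frechet_derivative (f \<circ> inv_into U x) (at (x p)) w else 0)"

lemma linear_chart_tvec:
  assumes "smooth_atlas A" "(U, x) \<in> A" "p \<in> U"
  shows "linear (chart_tvec A U x p)"
proof -
  have "linear (frechet_derivative (f \<circ> inv_into U x) (at (x p)))" if "smooth_near A p f" for f
    using smooth_near_differentiable[OF assms that]
    by (simp add: linear_frechet_derivative)
  then show ?thesis
    by (intro linearI) (auto simp: chart_tvec_def fun_eq_iff linear_add linear_scale)
qed

lemma eventually_curve_in:
  assumes "isCont c (0::real)" "open U" "c 0 \<in> U"
  shows "\<forall>\<^sub>F t in nhds 0. c t \<in> U"
  using topological_tendstoD[OF assms(1)[unfolded isCont_def tendsto_at_iff_tendsto_nhds] assms(2,3)] .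

text \<open>The chain rule through a chart. The curve is in \<open>U\<close> only for small times,
  so the two expressions for \<open>f \<circ> c\<close> agree only near 0. The codomain of
  \<open>f\<close> is left general: real functions and coordinate maps of other charts are both
  substituted.\<close>

lemma has_derivative_along_curve:
  assumes "smooth_atlas A" "(U, x) \<in> A" "p \<in> U"
    and c: "c 0 = p" "isCont c 0" "((x \<circ> c) has_vector_derivative w) (at 0)"
    and f: "(f \<circ> inv_into U x) differentiable (at (x p))"
  shows "((f \<circ> c) has_derivative
    (\<lambda>t. frechet_derivative (f \<circ> inv_into U x) (at (x p)) (t *\<^sub>R w))) (at 0)"
proof -
  note chart = smooth_atlas_chartD[OF assms(1,2)]
  have D: "((f \<circ> inv_into U x) has_derivative frechet_derivative (f \<circ> inv_into U x) (at (x p)))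
      (at ((x \<circ> c) 0))"
    using f c by (simp add: frechet_derivative_works)
  have "((f \<circ> inv_into U x) \<circ> (x \<circ> c) has_derivative
      frechet_derivative (f \<circ> inv_into U x) (at (x p)) \<circ> (\<lambda>t. t *\<^sub>R w)) (at 0)"
    by (rule diff_chain_at[OF c(3)[unfolded has_vector_derivative_def] D])
  moreover have "\<forall>\<^sub>F t in at 0. ((f \<circ> inv_into U x) \<circ> (x \<circ> c)) t = (f \<circ> c) t"
    using eventually_curve_in[OF c(2) chart(1)] c(1) assms(3) chart(3)
    by (auto simp: eventually_at_filter elim: eventually_mono)
  moreover have "((f \<circ> inv_into U x) \<circ> (x \<circ> c)) 0 = (f \<circ> c) 0"
    using c(1) assms(3) chart(3) by simp
  ultimately have "(f \<circ> c has_derivative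
      frechet_derivative (f \<circ> inv_into U x) (at (x p)) \<circ> (\<lambda>t. t *\<^sub>R w)) (at 0)"
    by (rule has_derivative_transform_eventually) simp
  then show ?thesis by (simp add: o_def)
qed

lemma chart_curve:
  assumes A: "smooth_atlas A" "(U, x) \<in> A" "p \<in> U"
    and c: "c 0 = p" "isCont c 0" "((x \<circ> c) has_vector_derivative w) (at 0)"
  shows "curve_at A p c" "velocity A p c = chart_tvec A U x p w"
    "smooth_near A p f \<Longrightarrow> ((f \<circ> c) has_real_derivative chart_tvec A U x p w f) (at 0)"
proof -
  have *: "((f \<circ> c) has_real_derivative chart_tvec A U x p w f) (at 0)" if "smooth_near A p f" for f
  proof -
    have D: "(f \<circ> inv_into U x) differentiable (at (x p))"
      using A that by (rule smooth_near_differentiable)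
    then have "frechet_derivative (f \<circ> inv_into U x) (at (x p)) (t *\<^sub>R w) =
      chart_tvec A U x p w f * t" for t
      using that by (simp add: chart_tvec_def linear_scale linear_frechet_derivative)
    then show ?thesis
      using has_derivative_along_curve[OF A c D] by (simp add: has_field_derivative_def)
  qed
  then show "smooth_near A p f \<Longrightarrow> ((f \<circ> c) has_real_derivative chart_tvec A U x p w f) (at 0)" .
  show "velocity A p c = chart_tvec A U x p w"
  proof
    fix f show "velocity A p c f = chart_tvec A U x p w f"
      using DERIV_imp_deriv[OF *[of f]] by (auto simp: velocity_def chart_tvec_def)
  qed
  show "curve_at A p c"
    unfolding curve_at_def
  proof (intro conjI c(1,2); clarify)
    fix V y assume V: "(V, y) \<in> A" "p \<in> V"
    show "(y \<circ> c) differentiable (at 0)"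
      using has_derivative_along_curve[OF A c smooth_atlas_transition_differentiable[OF A(1,2) V(1) A(3) V(2)]]
      by (auto simp: differentiable_def)
  qed
qed

lemma curve_at_chart:
  assumes A: "smooth_atlas A" "(U, x) \<in> A" "p \<in> U" and c: "curve_at A p c"
  obtains w where "((x \<circ> c) has_vector_derivative w) (at 0)"
proof -
  have "(x \<circ> c) differentiable (at 0)" using A c unfolding curve_at_def by auto
  then show ?thesis using that by (auto simp: vector_derivative_works)
qed

lemma velocity_has_derivative:
  assumes "smooth_atlas A" "curve_at A p c" "smooth_near A p f"
  shows "((f \<circ> c) has_real_derivative velocity A p c f) (at 0)"
proof -
  obtain U x where U: "(U, x) \<in> A" "p \<in> U" using smooth_atlas_cover[OF assms(1)] .
  obtain w where w: "((x \<circ> c) has_vector_derivative w) (at 0)"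
    using curve_at_chart[OF assms(1) U assms(2)] .
  have c: "c 0 = p" "isCont c 0" using assms(2) by (auto simp: curve_at_def)
  show ?thesis using chart_curve(2,3)[OF assms(1) U c w] assms(3) by simp
qed

lemma tangent_spaceE:
  assumes "v \<in> tangent_space A S p"
  obtains c where "v = velocity A p c" "curve_at A p c" "c 0 = p" "isCont c 0" "range c \<subseteq> S"
  using assms by (auto simp: tangent_space_def curve_at_def[of A p])

lemma tangent_space_mono: "S \<subseteq> T \<Longrightarrow> tangent_space A S p \<subseteq> tangent_space A T p"
  unfolding tangent_space_def by blast

text \<open>The vector is the velocity of a curve inside \<open>S\<close>, along which
  \<open>f\<close> and \<open>g\<close> agree for small times. This makes the connection along
  \<open>S\<close> independent of how components are extended off \<open>S\<close>.\<close>

lemma tangent_space_cong_fun: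
  assumes A: "smooth_atlas A" and v: "v \<in> tangent_space A S p"
    and fg: "smooth_near A p f" "smooth_near A p g"
    and W: "open W" "p \<in> W" "\<And>q. q \<in> W \<inter> S \<Longrightarrow> f q = g q"
  shows "v f = v g"
proof -
  obtain c where c: "v = velocity A p c" "curve_at A p c" "c 0 = p" "isCont c 0" "range c \<subseteq> S"
    using v by (rule tangent_spaceE)
  have "\<forall>\<^sub>F t in nhds 0. (f \<circ> c) t = (g \<circ> c) t"
    using eventually_curve_in[OF c(4) W(1)] c(3,5) W(2,3) by (auto elim!: eventually_mono)
  then have "deriv (f \<circ> c) 0 = deriv (g \<circ> c) 0" by (intro deriv_cong_ev) auto
  then show ?thesis using fg c(1) by (simp add: velocity_def)
qed

text \<open>Velocities of curves have no evident sum; as the range of a linear map they form a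
  subspace, of dimension at most \<open>DIM('e)\<close>.\<close>

lemma tangent_space_UNIV_eq_range:
  assumes A: "smooth_atlas A" "(U, x) \<in> A" "p \<in> U"
  shows "tangent_space A UNIV p = range (chart_tvec A U x p)"
proof
  show "tangent_space A UNIV p \<subseteq> range (chart_tvec A U x p)"
  proof
    fix v assume "v \<in> tangent_space A UNIV p"
    then obtain c where c: "v = velocity A p c" "curve_at A p c" "c 0 = p" "isCont c 0"
      by (rule tangent_spaceE)
    obtain w where "((x \<circ> c) has_vector_derivative w) (at 0)"
      using curve_at_chart[OF A c(2)] .
    then show "v \<in> range (chart_tvec A U x p)" using chart_curve(2)[OF A c(3,4)] c(1) by blast
  qed
  note chart = smooth_atlas_chartD[OF A(1,2)]
  show "range (chart_tvec A U x p) \<subseteq> tangent_space A UNIV p"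
  proof clarify
    fix w
    define c where "c t = inv_into U x (x p + t *\<^sub>R w)" for t :: real
    have "isCont (inv_into U x) (x p)"
      using chart(2,5) A(3) by (simp add: continuous_on_eq_continuous_at)
    then have "isCont c 0"
      unfolding c_def by (intro isCont_o2[of 0 _ "inv_into U x"]) (auto intro!: continuous_intros)
    moreover have "c 0 = p" using chart(3) A(3) by (simp add: c_def)
    moreover have "((x \<circ> c) has_vector_derivative w) (at 0)"
    proof (rule has_vector_derivative_transform_within_open)
      show "((\<lambda>t. x p + t *\<^sub>R w) has_vector_derivative w) (at 0)"
        by (auto intro!: derivative_eq_intros)
      show "open ((\<lambda>t::real. x p + t *\<^sub>R w) -` (x ` U))"
        by (rule open_vimage[OF chart(2)]) (intro continuous_intros)
    qed (use A in \<open>auto simp: c_def f_inv_into_f\<close>)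
    ultimately have "curve_at A p c" "velocity A p c = chart_tvec A U x p w"
      using chart_curve[OF A] by blast+
    then show "chart_tvec A U x p w \<in> tangent_space A UNIV p"
      unfolding tangent_space_def by (metis (mono_tags, lifting) mem_Collect_eq subset_UNIV)
  qed
qed

lemma subspace_tangent_space_UNIV:
  assumes "smooth_atlas A"
  shows "subspace (tangent_space A UNIV p)"
proof -
  obtain U x where U: "(U, x) \<in> A" "p \<in> U" using smooth_atlas_cover[OF assms] .
  show ?thesis
    using linear_subspace_image[OF linear_chart_tvec[OF assms U] subspace_UNIV]
    by (simp add: tangent_space_UNIV_eq_range[OF assms U])
qed

text \<open>Along curves in \<open>S\<close> the function is constantly 0; conversely a curve in the
  level set is built in a chart and lifted. The two inclusions for \<open>S\<close> allow for a zero
  set with its critical points removed: such a set is the full zero set only near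
  \<open>p\<close>.\<close>

lemma tangent_space_level_set:
  assumes A: "smooth_atlas A" and W: "open W" "p \<in> W" "p \<in> S"
    and f: "smooth_fun_on A UNIV f"
    and S: "S \<subseteq> {q. f q = 0}" "{q \<in> W. f q = 0} \<subseteq> S"
    and u: "u \<in> tangent_space A UNIV p" "u f \<noteq> 0"
  shows "tangent_space A S p = {v \<in> tangent_space A UNIV p. v f = 0}"
proof (intro subset_antisym subsetI)
  have near: "smooth_near A p f" using f unfolding smooth_near_def by blast
  have fp: "f p = 0" using W S by blast
  {
    fix v assume v: "v \<in> tangent_space A S p"
    obtain c where c: "v = velocity A p c" "curve_at A p c" "c 0 = p" "isCont c 0" "range c \<subseteq> S"
      using v by (rule tangent_spaceE)
    have "f \<circ> c = (\<lambda>t. 0)" using c(5) S(1) by (fastforce simp: fun_eq_iff)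
    then have "v f = 0" using c(1) by (simp add: velocity_def)
    then show "v \<in> {v \<in> tangent_space A UNIV p. v f = 0}"
      using v tangent_space_mono[OF subset_UNIV] by blast
  next
    fix v assume v: "v \<in> {v \<in> tangent_space A UNIV p. v f = 0}"
    obtain U x where U: "(U, x) \<in> A" "p \<in> U" using smooth_atlas_cover[OF A] .
    note chart = smooth_atlas_chartD[OF A U(1)] and T = tangent_space_UNIV_eq_range[OF A U]
    \<comment> \<open>\<open>w\<close> is the velocity to be realised; \<open>z\<close> supplies the
      transversal direction along which the line is corrected.\<close>
    obtain w z where w: "v = chart_tvec A U x p w" and z: "u = chart_tvec A U x p z"
      using u v T by auto
    define g where "g = f \<circ> inv_into U x"
    have D: "(g has_derivative frechet_derivative g (at (x p))) (at (x p))"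
      using smooth_near_differentiable[OF A U near] by (simp add: frechet_derivative_works g_def)
    have "continuous_on (x ` (U \<inter> W)) g"
      using smooth_on_continuous f U(1) unfolding smooth_fun_on_def g_def
      by (fastforce intro: continuous_on_subset)
    moreover have "frechet_derivative g (at (x p)) w = 0" "frechet_derivative g (at (x p)) z \<noteq> 0"
      using v u near by (simp_all add: w z chart_tvec_def g_def)
    moreover have "g (x p) = 0" using fp chart(3) U by (simp add: g_def)
    moreover have "open (x ` (U \<inter> W))" "x p \<in> x ` (U \<inter> W)"
      using smooth_atlas_open_image[OF A U(1) W(1)] U W by auto
    ultimately obtain \<gamma> where \<gamma>: "\<gamma> 0 = x p" "(\<gamma> has_vector_derivative w) (at 0)"
      "\<And>t. \<gamma> t \<in> x ` (U \<inter> W) \<and> g (\<gamma> t) = 0"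
      using D curve_in_level_set[of "x ` (U \<inter> W)" "x p" g _ w z] by metis
    define c where "c = inv_into U x \<circ> \<gamma>"
    have "x (c t) = \<gamma> t" for t
      using \<gamma>(3)[of t] by (auto simp: c_def intro: f_inv_into_f)
    then have xc: "x \<circ> c = \<gamma>" by (simp add: fun_eq_iff)
    have cS: "c t \<in> S" for t
    proof -
      obtain q where q: "q \<in> U" "q \<in> W" "\<gamma> t = x q" using \<gamma>(3)[of t] by auto
      then have "c t = q" using chart(3) by (simp add: c_def)
      moreover have "f q = 0" using \<gamma>(3)[of t] q chart(3) by (simp add: g_def)
      ultimately show ?thesis using q S by auto
    qed
    have "isCont (inv_into U x) (x p)"
      using chart(2,5) U by (simp add: continuous_on_eq_continuous_at)
    then have "isCont c 0"
      unfolding c_def using \<gamma>(1,2) has_vector_derivative_continuous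
      by (intro continuous_at_compose) auto
    moreover have "c 0 = p" using chart(3) U \<gamma>(1) by (simp add: c_def)
    ultimately have "curve_at A p c" "velocity A p c = v"
      using chart_curve[OF A U, of c w] \<gamma>(2) w xc by simp_all
    then show "v \<in> tangent_space A S p"
      using cS unfolding tangent_space_def by blast
  }
qed

section \<open>Frames and the flat connection\<close>

lemma smooth_fun_on_mult:
  assumes "smooth_atlas A" "open W" "smooth_fun_on A W f" "smooth_fun_on A W g"
  shows "smooth_fun_on A W (\<lambda>q. f q * g q)"
  unfolding smooth_fun_on_def
proof clarify
  fix U x assume "(U, x) \<in> A"
  then show "smooth_on (x ` (U \<inter> W)) ((\<lambda>q. f q * g q) \<circ> inv_into U x)"
    using assms smooth_atlas_open_image[OF assms(1) _ assms(2)]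
    by (auto simp: smooth_fun_on_def smooth_on_def o_def intro!: Ck_on_mult)
qed

lemma smooth_fun_on_add:
  assumes "smooth_atlas A" "open W" "smooth_fun_on A W f" "smooth_fun_on A W g"
  shows "smooth_fun_on A W (\<lambda>q. f q + g q)"
  unfolding smooth_fun_on_def
proof clarify
  fix U x assume "(U, x) \<in> A"
  then show "smooth_on (x ` (U \<inter> W)) ((\<lambda>q. f q + g q) \<circ> inv_into U x)"
    using assms smooth_atlas_open_image[OF assms(1) _ assms(2)]
    by (auto simp: smooth_fun_on_def smooth_on_def o_def intro!: Ck_on_add)
qed

lemma smooth_fun_on_powr:
  assumes "smooth_atlas A" "open W" "smooth_fun_on A W f" "\<And>q. q \<in> W \<Longrightarrow> f q > 0"
  shows "smooth_fun_on A W (\<lambda>q. f q powr a)"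
  unfolding smooth_fun_on_def
proof clarify
  fix U x assume U: "(U, x) \<in> A"
  have "Ck_on k (f \<circ> inv_into U x) (x ` (U \<inter> W))" for k
    using assms(3) U by (auto simp: smooth_fun_on_def smooth_on_def)
  moreover have "(f \<circ> inv_into U x) y > 0" if "y \<in> x ` (U \<inter> W)" for y
    using that assms(4) smooth_atlas_chartD(3)[OF assms(1) U] by auto
  ultimately show "smooth_on (x ` (U \<inter> W)) ((\<lambda>q. f q powr a) \<circ> inv_into U x)"
    using Ck_on_powr[OF smooth_atlas_open_image[OF assms(1) U assms(2)], of _ "f \<circ> inv_into U x" a]
    by (auto simp: smooth_on_def o_def)
qed

lemma smooth_fun_on_const: "smooth_fun_on A W (\<lambda>q. c)"
  by (auto simp: smooth_fun_on_def smooth_on_def o_def Ck_on_const)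

lemma smooth_fun_on_sum:
  assumes "smooth_atlas A" "open W" "\<And>i. i \<in> I \<Longrightarrow> smooth_fun_on A W (f i)"
  shows "smooth_fun_on A W (\<lambda>q. \<Sum>i\<in>I. f i q)"
  using assms(3)
  by (induction I rule: infinite_finite_induct)
    (auto intro: smooth_fun_on_const smooth_fun_on_add[OF assms(1,2)])

text \<open>Independence is stated through coefficients at each point, so that two fields with a
  common value are excluded as well.\<close>

locale tangent_frame =
  fixes A :: "('g::{t2_space,second_countable_topology}, 'e::euclidean_space) chart set"
    and E :: "nat \<Rightarrow> 'g vfield"
  assumes atlas: "smooth_atlas A"
    and smooth_vfield_frame: "k \<in> {1..DIM('e)} \<Longrightarrow> smooth_vfield A (E k)"
    and frame_sum_zero: "(\<Sum>k=1..DIM('e). c k *\<^sub>R E k p) = 0 \<Longrightarrow> \<forall>k\<in>{1..DIM('e)}. c k = 0"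
begin

lemma frame_tangent: "k \<in> {1..DIM('e)} \<Longrightarrow> E k p \<in> tangent_space A UNIV p"
  using smooth_vfield_frame unfolding smooth_vfield_def by blast

lemma frame_smooth:
  "k \<in> {1..DIM('e)} \<Longrightarrow> smooth_fun_on A UNIV f \<Longrightarrow> smooth_fun_on A UNIV (\<lambda>q. E k q f)"
  using smooth_vfield_frame unfolding smooth_vfield_def by blast

lemma inj_frame: "inj_on (\<lambda>k. E k p) {1..DIM('e)}"
  and independent_frame: "independent ((\<lambda>k. E k p) ` {1..DIM('e)})"
  by (rule independent_imageI; use frame_sum_zero in blast)+

text \<open>A chart spans the tangent space by at most \<open>DIM('e)\<close> vectors; that many
  independent ones then fill it.\<close>

lemma span_frame: "span ((\<lambda>k. E k p) ` {1..DIM('e)}) = tangent_space A UNIV p"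
proof -
  obtain U x where U: "(U, x) \<in> A" "p \<in> U" using smooth_atlas_cover[OF atlas] .
  have T: "tangent_space A UNIV p = span (chart_tvec A U x p ` Basis)"
    by (simp add: tangent_space_UNIV_eq_range[OF atlas U]
        linear_span_image[OF linear_chart_tvec[OF atlas U]])
  have "card (chart_tvec A U x p ` Basis) \<le> DIM('e)"
    by (rule card_image_le) simp
  then have "card (chart_tvec A U x p ` Basis) \<le> card ((\<lambda>k. E k p) ` {1..DIM('e)})"
    unfolding card_image[OF inj_frame] by simp
  then show ?thesis unfolding T
    using frame_tangent T
    by (intro span_eq_of_card_le independent_frame) auto
qed

lemma frame_sum_inject:
  assumes "(\<Sum>k=1..DIM('e). c k *\<^sub>R E k p) = (\<Sum>k=1..DIM('e). c' k *\<^sub>R E k p)" "k \<in> {1..DIM('e)}"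
  shows "c k = c' k"
  using inj_on_independent_sum_eq[OF inj_frame independent_frame _ assms(2,1)] by simp

text \<open>Shows that the definite description is well posed: on \<open>S\<close> the components
  are forced by independence of the frame, and \<open>v\<close> does not see their values off
  \<open>S\<close>.\<close>

lemma flat_connection_eq:
  assumes v: "v \<in> tangent_space A S p" and W: "open W" "p \<in> W"
    and F: "\<And>k. k \<in> {1..DIM('e)} \<Longrightarrow> smooth_fun_on A W (F k)"
    and \<xi>: "\<And>q. q \<in> W \<inter> S \<Longrightarrow> \<xi> q = (\<Sum>k=1..DIM('e). F k q *\<^sub>R E k q)"
  shows "flat_connection A E S p v \<xi> = (\<Sum>k=1..DIM('e). v (F k) *\<^sub>R E k p)"
  unfolding flat_connection_def
proof (rule the_equality)
  show "\<exists>F' U. open U \<and> p \<in> U \<and> (\<forall>k\<in>{1..DIM('e)}. smooth_fun_on A U (F' k)) \<and>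
      (\<forall>q\<in>U \<inter> S. \<xi> q = (\<Sum>k=1..DIM('e). F' k q *\<^sub>R E k q)) \<and>
      (\<Sum>k=1..DIM('e). v (F k) *\<^sub>R E k p) = (\<Sum>k=1..DIM('e). v (F' k) *\<^sub>R E k p)"
    using W F \<xi> by (intro exI[of _ F] exI[of _ W]) simp
next
  fix w assume "\<exists>F' U. open U \<and> p \<in> U \<and> (\<forall>k\<in>{1..DIM('e)}. smooth_fun_on A U (F' k)) \<and>
      (\<forall>q\<in>U \<inter> S. \<xi> q = (\<Sum>k=1..DIM('e). F' k q *\<^sub>R E k q)) \<and>
      w = (\<Sum>k=1..DIM('e). v (F' k) *\<^sub>R E k p)"
  then obtain F' U where U: "open U" "p \<in> U" "\<And>k. k \<in> {1..DIM('e)} \<Longrightarrow> smooth_fun_on A U (F' k)"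
    "\<And>q. q \<in> U \<inter> S \<Longrightarrow> \<xi> q = (\<Sum>k=1..DIM('e). F' k q *\<^sub>R E k q)"
    "w = (\<Sum>k=1..DIM('e). v (F' k) *\<^sub>R E k p)" by blast
  have "v (F' k) = v (F k)" if k: "k \<in> {1..DIM('e)}" for k
  proof (rule tangent_space_cong_fun[OF atlas v])
    show "smooth_near A p (F' k)" "smooth_near A p (F k)"
      using U F W k unfolding smooth_near_def by blast+
    show "open (U \<inter> W)" "p \<in> U \<inter> W" using U W by auto
    show "F' k q = F k q" if "q \<in> U \<inter> W \<inter> S" for q
      using frame_sum_inject[OF _ k, of "\<lambda>k. F' k q" q "\<lambda>k. F k q"] U(4)[of q] \<xi>[of q] that by auto
  qed
  then show "w = (\<Sum>k=1..DIM('e). v (F k) *\<^sub>R E k p)" using U(5) by simp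
qed

text \<open>Rewrites the divergence as a trace over the frame taken as a set of vectors, the form in
  which bases can be exchanged.\<close>

lemma divergence_eq:
  assumes W: "open W" "p \<in> W"
    and F: "\<And>k. k \<in> {1..DIM('e)} \<Longrightarrow> smooth_fun_on A W (F k)"
    and \<xi>: "\<And>q. q \<in> W \<Longrightarrow> \<xi> q = (\<Sum>k=1..DIM('e). F k q *\<^sub>R E k q)"
  shows "divergence A E \<xi> p = (\<Sum>b\<in>(\<lambda>k. E k p) ` {1..DIM('e)}.
    representation ((\<lambda>k. E k p) ` {1..DIM('e)}) (\<Sum>k=1..DIM('e). b (F k) *\<^sub>R E k p) b)"
  unfolding divergence_def dual_basis_def sum.reindex[OF inj_frame]
proof (rule sum.cong[OF refl])
  fix j assume j: "j \<in> {1..DIM('e)}"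
  have "flat_connection A E UNIV p (E j p) \<xi> = (\<Sum>k=1..DIM('e). E j p (F k) *\<^sub>R E k p)"
    by (rule flat_connection_eq[OF frame_tangent[OF j] W F]) (use \<xi> in auto)
  then show "representation ((\<lambda>k. E k p) ` {1..DIM('e)}) (flat_connection A E UNIV p (E j p) \<xi>) (E j p) =
      ((\<lambda>b. representation ((\<lambda>k. E k p) ` {1..DIM('e)}) (\<Sum>k=1..DIM('e). b (F k) *\<^sub>R E k p) b) \<circ>
        (\<lambda>k. E k p)) j"
    by simp
qed

end

section \<open>Regular level sets and their horizontal unit normal\<close>

locale horizontal_frame = tangent_frame A E
  for A :: "('g::{t2_space,second_countable_topology}, 'e::euclidean_space) chart set" and E +
  fixes d :: nat and V1 :: "'g vfield set" and h :: "'g \<Rightarrow> 'g tvec \<Rightarrow> 'g tvec \<Rightarrow> real"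
    and \<phi> :: "'g \<Rightarrow> real"
  assumes d_le: "d \<le> DIM('e)"
    and distribution_eq: "distribution V1 p = span ((\<lambda>i. E i p) ` {1..d})"
    and metric_eq: "h p (\<Sum>i=1..d. a i *\<^sub>R E i p) (\<Sum>i=1..d. b i *\<^sub>R E i p) = (\<Sum>i=1..d. a i * b i)"
    and smooth_\<phi>: "smooth_fun_on A UNIV \<phi>"
begin

abbreviation "M \<equiv> {x. \<phi> x = 0 \<and> hgrad d E \<phi> x \<noteq> 0}"

definition f1 :: "'g vfield"
  where "f1 x = (1 / norm_hgrad d E \<phi> x) *\<^sub>R hgrad d E \<phi> x"

text \<open>The components of \<open>f1\<close>; the real power of 0 is 0, as is division by 0.\<close>

definition comp :: "nat \<Rightarrow> 'g \<Rightarrow> real"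
  where "comp k q = (if k \<le> d then E k q \<phi> * (\<Sum>i=1..d. (E i q \<phi>)\<^sup>2) powr (-1/2) else 0)"

lemma frame_sum_d:
  "(\<Sum>i=1..d. c i *\<^sub>R E i p) = (\<Sum>i=1..DIM('e). (if i \<le> d then c i else 0) *\<^sub>R E i p)"
proof -
  have "(\<Sum>i=1..DIM('e). (if i \<le> d then c i else 0) *\<^sub>R E i p) =
      (\<Sum>i=1..d. (if i \<le> d then c i else 0) *\<^sub>R E i p)"
    using d_le by (intro sum.mono_neutral_right) auto
  then show ?thesis by simp
qed

lemma hgrad_eq_0_iff: "hgrad d E \<phi> p = 0 \<longleftrightarrow> norm_hgrad d E \<phi> p = 0"
proof
  assume "hgrad d E \<phi> p = 0"
  then have z: "\<forall>i\<in>{1..DIM('e)}. (if i \<le> d then E i p \<phi> else 0) = 0"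
    unfolding hgrad_def frame_sum_d by (rule frame_sum_zero)
  have "E i p \<phi> = 0" if "i \<in> {1..d}" for i
    using bspec[OF z, of i] that d_le by simp
  then show "norm_hgrad d E \<phi> p = 0" by (simp add: norm_hgrad_def)
next
  assume "norm_hgrad d E \<phi> p = 0"
  then show "hgrad d E \<phi> p = 0"
    by (simp add: norm_hgrad_def hgrad_def sum_nonneg_eq_0_iff)
qed

lemma norm_hgrad_sq: "(norm_hgrad d E \<phi> p)\<^sup>2 = (\<Sum>i=1..d. (E i p \<phi>)\<^sup>2)"
  by (simp add: norm_hgrad_def sum_nonneg)

lemma norm_hgrad_pos_iff: "norm_hgrad d E \<phi> p > 0 \<longleftrightarrow> hgrad d E \<phi> p \<noteq> 0"
proof -
  have "norm_hgrad d E \<phi> p \<ge> 0" by (simp add: norm_hgrad_def sum_nonneg)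
  then show ?thesis unfolding hgrad_eq_0_iff by linarith
qed

text \<open>The power form gives smoothness, the quotient form serves the algebra.\<close>

lemma comp_eq: "comp k q = (if k \<le> d then E k q \<phi> / norm_hgrad d E \<phi> q else 0)"
proof -
  have "x powr (-1/2) = 1 / sqrt x" if "x \<ge> 0" for x :: real
    using that powr_minus_divide[of x "1/2"] by (simp add: powr_half_sqrt)
  from this[of "\<Sum>i=1..d. (E i q \<phi>)\<^sup>2"] show ?thesis
    by (simp add: comp_def norm_hgrad_def sum_nonneg)
qed

lemma f1_eq_d: "f1 q = (\<Sum>k=1..d. comp k q *\<^sub>R E k q)"
  by (simp add: f1_def hgrad_def scaleR_sum_right comp_eq)

lemma f1_eq: "f1 q = (\<Sum>k=1..DIM('e). comp k q *\<^sub>R E k q)"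
  unfolding f1_eq_d frame_sum_d by (intro sum.cong) (auto simp: comp_def)

lemma comp_unit:
  assumes "hgrad d E \<phi> q \<noteq> 0"
  shows "(\<Sum>k=1..DIM('e). (comp k q)\<^sup>2) = 1"
proof -
  have "(\<Sum>k=1..DIM('e). (comp k q)\<^sup>2) = (\<Sum>k=1..d. (comp k q)\<^sup>2)"
    using d_le by (intro sum.mono_neutral_right) (auto simp: comp_def)
  also have "\<dots> = (\<Sum>k=1..d. (E k q \<phi>)\<^sup>2) / (norm_hgrad d E \<phi> q)\<^sup>2"
    by (simp add: comp_eq power_divide sum_divide_distrib)
  also have "\<dots> = 1" unfolding norm_hgrad_sq[symmetric] using assms by (simp add: hgrad_eq_0_iff)
  finally show ?thesis .
qed

lemma smooth_sum_sq: "smooth_fun_on A UNIV (\<lambda>q. \<Sum>i=1..d. (E i q \<phi>)\<^sup>2)"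
  unfolding power2_eq_square
  using d_le by (intro smooth_fun_on_sum smooth_fun_on_mult atlas frame_smooth smooth_\<phi>) auto

lemma open_regular: "open {q. hgrad d E \<phi> q \<noteq> 0}"
proof -
  have "{q. hgrad d E \<phi> q \<noteq> 0} = (\<lambda>q. \<Sum>i=1..d. (E i q \<phi>)\<^sup>2) -` (- {0})"
    by (auto simp: hgrad_eq_0_iff norm_hgrad_def)
  then show ?thesis
    using smooth_fun_on_continuous[OF atlas open_UNIV smooth_sum_sq]
    by (metis open_vimage open_Compl closed_singleton)
qed

lemma smooth_comp:
  assumes "k \<in> {1..DIM('e)}"
  shows "smooth_fun_on A {q. hgrad d E \<phi> q \<noteq> 0} (comp k)"
proof (cases "k \<le> d")
  case True
  have "smooth_fun_on A {q. hgrad d E \<phi> q \<noteq> 0}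
      (\<lambda>q. E k q \<phi> * (\<Sum>i=1..d. (E i q \<phi>)\<^sup>2) powr (-1/2))"
  proof (intro smooth_fun_on_mult smooth_fun_on_powr atlas open_regular)
    show "0 < (\<Sum>i=1..d. (E i q \<phi>)\<^sup>2)" if "q \<in> {q. hgrad d E \<phi> q \<noteq> 0}" for q
      unfolding norm_hgrad_sq[symmetric] using that norm_hgrad_pos_iff[of q] by simp
  qed (use smooth_fun_on_subset frame_smooth[OF assms smooth_\<phi>] smooth_sum_sq in blast)+
  then show ?thesis using True by (simp add: comp_def[abs_def])
qed (simp add: comp_def[abs_def] smooth_fun_on_const)

lemma horizontal_tangent: "distribution V1 p \<subseteq> tangent_space A UNIV p"
  unfolding distribution_eq span_frame[symmetric] using d_le by (intro span_mono image_mono) auto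

lemma f1_horizontal: "f1 p \<in> distribution V1 p"
  unfolding f1_eq_d distribution_eq by (intro span_sum span_scale span_base) auto

lemma f1_tangent: "f1 p \<in> tangent_space A UNIV p"
  using f1_horizontal horizontal_tangent by blast

text \<open>The source of transversality: this derivative is positive on \<open>M\<close>, so
  \<open>f1\<close> is not tangent to \<open>M\<close>, and it is the scale of the projection along
  \<open>f1\<close>.\<close>

lemma f1_\<phi>: "f1 p \<phi> = norm_hgrad d E \<phi> p"
proof -
  have "f1 p \<phi> = (\<Sum>i=1..d. (E i p \<phi>)\<^sup>2) / norm_hgrad d E \<phi> p"
    by (simp add: f1_def hgrad_def fun_sum_apply power2_eq_square)
  then show ?thesis unfolding norm_hgrad_sq[symmetric] by (simp add: power2_eq_square)
qed

lemma tangent_space_M: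
  assumes "p \<in> M"
  shows "tangent_space A M p = {v \<in> tangent_space A UNIV p. v \<phi> = 0}"
proof (rule tangent_space_level_set[OF atlas open_regular _ assms smooth_\<phi>])
  show "f1 p \<in> tangent_space A UNIV p" by (rule f1_tangent)
  show "f1 p \<phi> \<noteq> 0" using assms norm_hgrad_pos_iff[of p] unfolding f1_\<phi> by simp
qed (use assms in auto)

lemma hypersurface_M: "hypersurface A M"
  unfolding hypersurface_def
proof
  fix p assume "p \<in> M"
  moreover have "\<exists>v\<in>tangent_space A UNIV q. v \<phi> \<noteq> 0" if "q \<in> M" for q
    using that f1_tangent[of q] f1_\<phi>[of q] norm_hgrad_pos_iff[of q] by (metis (mono_tags, lifting) less_irrefl mem_Collect_eq)
  ultimately show "\<exists>U \<psi>. open U \<and> p \<in> U \<and> smooth_fun_on A U \<psi> \<and> M \<inter> U = {q \<in> U. \<psi> q = 0} \<and>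
      (\<forall>q\<in>M \<inter> U. \<exists>v\<in>tangent_space A UNIV q. v \<psi> \<noteq> 0)"
    using open_regular smooth_fun_on_subset[OF smooth_\<phi>]
    by (intro exI[of _ "{q. hgrad d E \<phi> q \<noteq> 0}"] exI[of _ \<phi>]) auto
qed

text \<open>The projection onto the tangent space of M along \<open>f1\<close>.\<close>

lemma project_tangent:
  assumes "p \<in> M" "w \<in> tangent_space A UNIV p"
  shows "w - (w \<phi> / norm_hgrad d E \<phi> p) *\<^sub>R f1 p \<in> tangent_space A M p"
proof -
  have "norm_hgrad d E \<phi> p \<noteq> 0" using assms norm_hgrad_pos_iff[of p] by simp
  then have "(w - (w \<phi> / norm_hgrad d E \<phi> p) *\<^sub>R f1 p) \<phi> = 0"
    using f1_\<phi>[of p] by simp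
  moreover have "w - (w \<phi> / norm_hgrad d E \<phi> p) *\<^sub>R f1 p \<in> tangent_space A UNIV p"
    using assms f1_tangent subspace_tangent_space_UNIV[OF atlas]
    by (intro subspace_diff subspace_scale) auto
  ultimately show ?thesis unfolding tangent_space_M[OF assms(1)] by blast
qed

lemma non_horizontal_M: "non_horizontal A V1 M"
  unfolding non_horizontal_def
proof (intro ballI subset_antisym subsetI)
  fix p w assume p: "p \<in> M"
  {
    assume "w \<in> {u + v | u v. u \<in> tangent_space A M p \<and> v \<in> distribution V1 p}"
    then show "w \<in> tangent_space A UNIV p"
      using tangent_space_mono[of M UNIV A p] horizontal_tangent[of p]
      by (auto intro!: subspace_add[OF subspace_tangent_space_UNIV[OF atlas]])
  next
    assume "w \<in> tangent_space A UNIV p"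
    from project_tangent[OF p this]
    show "w \<in> {u + v | u v. u \<in> tangent_space A M p \<and> v \<in> distribution V1 p}"
      using f1_horizontal[of p] unfolding distribution_eq
      by (intro CollectI exI[of _ "w - (w \<phi> / norm_hgrad d E \<phi> p) *\<^sub>R f1 p"]
          exI[of _ "(w \<phi> / norm_hgrad d E \<phi> p) *\<^sub>R f1 p"]) (simp add: span_scale)
  }
qed

text \<open>For normal \<open>v\<close>, the vector \<open>v - c f1\<close> with \<open>c\<close>
  chosen to kill \<open>\<phi>\<close> is tangent and horizontal. It is orthogonal to
  \<open>v\<close> by assumption and to \<open>f1\<close> because it kills \<open>\<phi>\<close>,
  hence to itself, hence zero.\<close>

lemma horizontal_normal_M:
  assumes p: "p \<in> M"
  shows "horizontal_normal A V1 h M p = range (\<lambda>c. c *\<^sub>R f1 p)"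
proof (intro subset_antisym subsetI)
  let ?N = "norm_hgrad d E \<phi> p"
  have N: "?N > 0" using p norm_hgrad_pos_iff[of p] by simp
  {
    fix v assume "v \<in> horizontal_normal A V1 h M p"
    then have v: "v \<in> distribution V1 p"
      "\<And>u. u \<in> tangent_space A M p \<inter> distribution V1 p \<Longrightarrow> h p u v = 0"
      by (auto simp: horizontal_normal_def)
    have "v \<in> span ((\<lambda>i. E i p) ` {1..d})" using v(1) unfolding distribution_eq .
    then obtain b where b: "v = (\<Sum>i=1..d. b i *\<^sub>R E i p)"
      by (rule span_image_sum[OF finite_atLeastAtMost])
    define c where "c = v \<phi> / ?N"
    define a where "a i = b i - c * comp i p" for i
    have u: "v - c *\<^sub>R f1 p = (\<Sum>i=1..d. a i *\<^sub>R E i p)"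
      unfolding b f1_eq_d a_def by (simp add: scaleR_sum_right sum_subtractf scaleR_diff_left)
    have uT: "v - c *\<^sub>R f1 p \<in> tangent_space A M p"
      unfolding c_def using project_tangent[OF p] v(1) horizontal_tangent by blast
    moreover have "v - c *\<^sub>R f1 p \<in> distribution V1 p"
      using v(1) f1_horizontal[of p] unfolding distribution_eq by (intro span_diff span_scale)
    ultimately have "h p (v - c *\<^sub>R f1 p) v = 0" using v(2) by blast
    then have "(\<Sum>i=1..d. a i * b i) = 0" unfolding u unfolding b metric_eq .
    moreover have "(\<Sum>i=1..d. a i * comp i p) = 0"
    proof -
      have "(v - c *\<^sub>R f1 p) \<phi> = 0" using uT tangent_space_M[OF p] by blast
      then have "(\<Sum>i=1..d. a i * E i p \<phi>) = 0" unfolding u by (simp add: fun_sum_apply)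
      then show ?thesis by (simp add: comp_eq flip: sum_divide_distrib)
    qed
    \<comment> \<open>Since \<open>a = b - c comp\<close>, this difference is the squared length of
      \<open>v - c f1\<close>.\<close>
    ultimately have "(\<Sum>i=1..d. a i * b i) - c * (\<Sum>i=1..d. a i * comp i p) = 0" by simp
    then have "(\<Sum>i=1..d. (a i)\<^sup>2) = 0"
      by (simp add: sum_distrib_left power2_eq_square a_def right_diff_distrib mult.left_commute
          flip: sum_subtractf)
    then have "v - c *\<^sub>R f1 p = 0" unfolding u by (simp add: sum_nonneg_eq_0_iff)
    then show "v \<in> range (\<lambda>c. c *\<^sub>R f1 p)" by auto
  next
    fix v assume "v \<in> range (\<lambda>c. c *\<^sub>R f1 p)"
    then obtain c where c: "v = c *\<^sub>R f1 p" by blast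
    have "h p u v = 0" if "u \<in> tangent_space A M p \<inter> distribution V1 p" for u
    proof -
      have "u \<in> span ((\<lambda>i. E i p) ` {1..d})" using that unfolding distribution_eq by blast
      then obtain a where a: "u = (\<Sum>i=1..d. a i *\<^sub>R E i p)"
        by (rule span_image_sum[OF finite_atLeastAtMost])
      have "u \<phi> = 0" using that tangent_space_M[OF p] by blast
      then have "(\<Sum>i=1..d. a i * E i p \<phi>) = 0" unfolding a by (simp add: fun_sum_apply)
      then have "(\<Sum>i=1..d. a i * (c * comp i p)) = 0"
        by (simp add: comp_eq flip: sum_divide_distrib sum_distrib_left add: mult.left_commute)
      moreover have "v = (\<Sum>i=1..d. (c * comp i p) *\<^sub>R E i p)"
        unfolding c f1_eq_d by (simp add: scaleR_sum_right)
      ultimately show ?thesis by (simp only: a metric_eq)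
    qed
    moreover have "v \<in> distribution V1 p"
      using f1_horizontal[of p] unfolding c distribution_eq by (rule span_scale)
    ultimately show "v \<in> horizontal_normal A V1 h M p" unfolding horizontal_normal_def by blast
  }
qed

text \<open>Tangent vectors of \<open>M\<close> kill \<open>\<phi>\<close>, so evaluating at
  \<open>\<phi>\<close> determines the component along \<open>f1\<close>; this gives the uniqueness
  behind the definite description.\<close>

lemma tangential_part_M:
  assumes p: "p \<in> M" and w: "w \<in> tangent_space A UNIV p"
  shows "tangential_part A V1 h M p w = w - (w \<phi> / norm_hgrad d E \<phi> p) *\<^sub>R f1 p"
  unfolding tangential_part_def horizontal_normal_M[OF p]
proof (rule the_equality)
  show "w - (w \<phi> / norm_hgrad d E \<phi> p) *\<^sub>R f1 p \<in> tangent_space A M p \<and>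
      w - (w - (w \<phi> / norm_hgrad d E \<phi> p) *\<^sub>R f1 p) \<in> range (\<lambda>c. c *\<^sub>R f1 p)"
    using project_tangent[OF assms] rangeI[of "\<lambda>c. c *\<^sub>R f1 p"] by simp
next
  fix u assume "u \<in> tangent_space A M p \<and> w - u \<in> range (\<lambda>c. c *\<^sub>R f1 p)"
  then obtain c where u: "u \<phi> = 0" "w - u = c *\<^sub>R f1 p" using tangent_space_M[OF p] by blast
  have "w \<phi> - u \<phi> = c * f1 p \<phi>" using arg_cong[OF u(2), of "\<lambda>v. v \<phi>"] by simp
  then have "w \<phi> = c * norm_hgrad d E \<phi> p" using u(1) f1_\<phi>[of p] by simp
  then have "c = w \<phi> / norm_hgrad d E \<phi> p"
    using p norm_hgrad_pos_iff[of p] by simp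
  then show "u = w - (w \<phi> / norm_hgrad d E \<phi> p) *\<^sub>R f1 p" using u(2) by (simp add: algebra_simps)
qed

section \<open>Derivative of the unit normal and its trace\<close>

text \<open>On \<open>M\<close>, the common value of the connection along \<open>M\<close> and in
  the group. It accepts arbitrary functionals, so it is linear on the whole space, as the change of
  basis requires.\<close>

definition deriv_f1 :: "'g \<Rightarrow> 'g tvec \<Rightarrow> 'g tvec"
  where "deriv_f1 p v = (\<Sum>k=1..DIM('e). v (comp k) *\<^sub>R E k p)"

lemma linear_deriv_f1: "linear (deriv_f1 p)"
  by (rule linearI) (simp_all add: deriv_f1_def scaleR_add_left sum.distrib scaleR_sum_right)

lemma deriv_f1_tangent: "deriv_f1 p v \<in> tangent_space A UNIV p"
  unfolding deriv_f1_def span_frame[symmetric] by (intro span_sum span_scale span_base) auto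

text \<open>Differentiating |f1|^2 = 1 along a curve with velocity \<open>v\<close> gives it; the
  identity holds on an open set, so \<open>v\<close> may be transversal to \<open>M\<close>.\<close>

lemma deriv_f1_normal:
  assumes p: "p \<in> M" and v: "v \<in> tangent_space A UNIV p"
  shows "deriv_f1 p v \<phi> = 0"
proof -
  obtain c where c: "v = velocity A p c" "curve_at A p c" "c 0 = p" "isCont c 0" "range c \<subseteq> UNIV"
    using v by (rule tangent_spaceE)
  let ?R = "{q. hgrad d E \<phi> q \<noteq> 0}"
  have D: "((\<lambda>t. comp k (c t)) has_real_derivative v (comp k)) (at 0)" if "k \<in> {1..DIM('e)}" for k
    unfolding c(1)
  proof (rule velocity_has_derivative[OF atlas c(2), unfolded o_def])
    show "smooth_near A p (comp k)"
      unfolding smooth_near_def using smooth_comp[OF that] open_regular p by blast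
  qed
  have "((\<lambda>t. \<Sum>k=1..DIM('e). (comp k (c t))\<^sup>2) has_real_derivative
      (\<Sum>k=1..DIM('e). 2 * comp k p * v (comp k))) (at 0)"
    using D c(3) by (intro DERIV_sum) (auto intro!: derivative_eq_intros)
  moreover have "\<forall>\<^sub>F t in nhds 0. (\<Sum>k=1..DIM('e). (comp k (c t))\<^sup>2) = 1"
    using eventually_curve_in[OF c(4) open_regular] p c(3) comp_unit
    by (auto elim!: eventually_mono)
  ultimately have "((\<lambda>t. 1) has_real_derivative (\<Sum>k=1..DIM('e). 2 * comp k p * v (comp k))) (at (0::real))"
    by (subst (asm) DERIV_cong_ev[OF refl _ refl]) auto
  then have "(\<Sum>k=1..DIM('e). 2 * comp k p * v (comp k)) = 0"
    using DERIV_const DERIV_unique by blast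
  then have 0: "(\<Sum>k=1..DIM('e). v (comp k) * comp k p) = 0"
    by (simp add: mult.assoc mult.commute[of "v _"] flip: sum_distrib_left)
  \<comment> \<open>Up to the factor |grad|, the horizontal components of \<open>f1\<close> are the
    derivatives of \<open>\<phi>\<close>. For \<open>k > d\<close> the component is identically 0,
    so \<open>v\<close> kills it whatever \<open>E k p \<phi>\<close> is.\<close>
  have *: "v (comp k) * E k p \<phi> = norm_hgrad d E \<phi> p * (v (comp k) * comp k p)" for k
  proof (cases "k \<le> d")
    case True
    then show ?thesis using p by (simp add: comp_eq hgrad_eq_0_iff)
  next
    case False
    then have "comp k = (\<lambda>q. 0)" by (simp add: comp_def[abs_def])
    moreover have "v (\<lambda>q. 0) = 0" by (simp add: c(1) velocity_def o_def)
    ultimately show ?thesis by simp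
  qed
  have "deriv_f1 p v \<phi> = (\<Sum>k=1..DIM('e). v (comp k) * E k p \<phi>)"
    by (simp add: deriv_f1_def fun_sum_apply)
  also have "\<dots> = norm_hgrad d E \<phi> p * (\<Sum>k=1..DIM('e). v (comp k) * comp k p)"
    by (simp only: * sum_distrib_left)
  finally have "deriv_f1 p v \<phi> = norm_hgrad d E \<phi> p * (\<Sum>k=1..DIM('e). v (comp k) * comp k p)" .
  then show ?thesis using 0 by simp
qed

lemma mean_curvature_M:
  assumes p: "p \<in> M"
  shows "mean_curvature A V1 h E M f1 p = divergence A E f1 p"
proof -
  have sub: "subspace (tangent_space A M p)"
    using subspace_tangent_space_UNIV[OF atlas, of p]
    unfolding tangent_space_M[OF p] subspace_def by simp
  \<comment> \<open>Verbatim the basis chosen inside \<open>trace_on\<close>, so the trace over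
    \<open>M\<close> can be matched by unfolding at the end.\<close>
  define B where "B = (SOME B. independent B \<and> span B = tangent_space A M p)"
  obtain B' where "B' \<subseteq> tangent_space A M p" "independent B'" "tangent_space A M p \<subseteq> span B'"
    using maximal_independent_subset by blast
  then have "independent B' \<and> span B' = tangent_space A M p"
    using span_minimal[OF _ sub] by blast
  then have B: "independent B" "span B = tangent_space A M p"
    using someI[of "\<lambda>B. independent B \<and> span B = tangent_space A M p" B'] unfolding B_def by blast+
  let ?F = "(\<lambda>k. E k p) ` {1..DIM('e)}"
  have "B \<subseteq> span ?F" unfolding span_frame using B(2) span_superset tangent_space_mono[OF subset_UNIV] by blast
  then have finB: "finite B" using independent_span_bound[OF _ B(1)] by blast
  have f1B: "f1 p \<notin> span B"
  proof
    assume "f1 p \<in> span B"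
    then have "f1 p \<phi> = 0" unfolding B(2) tangent_space_M[OF p] by blast
    then show False using p norm_hgrad_pos_iff[of p] unfolding f1_\<phi> by simp
  qed
  define C where "C = insert (f1 p) B"
  have C: "independent C" "finite C"
    using f1B B(1) finB by (auto simp: C_def independent_insertI)
  have spanC: "span C = span ?F"
  proof (intro subset_antisym span_minimal subspace_span)
    show "C \<subseteq> span ?F" using \<open>B \<subseteq> span ?F\<close> f1_tangent[of p] unfolding C_def span_frame by blast
    show "?F \<subseteq> span C"
    proof
      fix w assume "w \<in> ?F"
      then have "w \<in> tangent_space A UNIV p" using frame_tangent by blast
      then have "w - (w \<phi> / norm_hgrad d E \<phi> p) *\<^sub>R f1 p \<in> span B"
        using project_tangent[OF p] B(2) by blast
      then show "w \<in> span C" unfolding C_def span_insert by blast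
    qed
  qed
  have dB: "deriv_f1 p b \<in> span B" if "b \<in> tangent_space A UNIV p" for b
    using deriv_f1_normal[OF p that] deriv_f1_tangent B(2) tangent_space_M[OF p] by blast
  have W: "weingarten A V1 h E M f1 p b = - deriv_f1 p b" if "b \<in> B" for b
  proof -
    have b: "b \<in> tangent_space A M p" using that B(2) span_base by blast
    have "flat_connection A E M p b f1 = deriv_f1 p b"
      unfolding deriv_f1_def
      using flat_connection_eq[OF b open_regular _ smooth_comp f1_eq] p by simp
    moreover have "deriv_f1 p b \<phi> = 0"
      using deriv_f1_normal[OF p] b tangent_space_mono[OF subset_UNIV] by blast
    ultimately show ?thesis
      using tangential_part_M[OF p deriv_f1_tangent] by (simp add: weingarten_def)
  qed
  have "divergence A E f1 p = (\<Sum>b\<in>?F. representation ?F (deriv_f1 p b) b)"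
    unfolding deriv_f1_def using divergence_eq[OF open_regular _ smooth_comp f1_eq] p by simp
  also have "\<dots> = (\<Sum>b\<in>C. representation C (deriv_f1 p b) b)"
  proof (rule trace_basis_change[OF linear_deriv_f1 _ independent_frame _ C])
    show "deriv_f1 p v \<in> span ?F" for v using deriv_f1_tangent unfolding span_frame .
  qed (use spanC in auto)
  \<comment> \<open>All images lie in \<open>span B\<close>, including that of \<open>f1 p\<close>,
    so their coefficients with respect to \<open>C\<close> and \<open>B\<close> agree.\<close>
  also have "\<dots> = (\<Sum>b\<in>C. representation B (deriv_f1 p b) b)"
  proof (rule sum.cong[OF refl])
    fix b assume "b \<in> C"
    then have "b \<in> tangent_space A UNIV p" using spanC span_frame span_base by metis
    then show "representation C (deriv_f1 p b) b = representation B (deriv_f1 p b) b"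
      using representation_extend[OF C(1) dB, of b] by (simp add: C_def subset_insertI)
  qed
  also have "\<dots> = (\<Sum>b\<in>B. representation B (deriv_f1 p b) b)"
  proof -
    \<comment> \<open>A representation vanishes off its basis, so the diagonal entry at
      \<open>f1 p\<close> is 0.\<close>
    have "representation B (deriv_f1 p (f1 p)) (f1 p) = 0"
      using f1B representation_ne_zero[of B _ "f1 p"] span_base by blast
    moreover have "f1 p \<notin> B" using f1B span_base by blast
    ultimately show ?thesis using finB by (simp add: C_def)
  qed
  also have "\<dots> = - (\<Sum>b\<in>B. representation B (- deriv_f1 p b) b)"
    unfolding sum_negf[symmetric]
  proof (rule sum.cong[OF refl])
    fix b assume "b \<in> B"
    then have "deriv_f1 p b \<in> span B" using dB \<open>B \<subseteq> span ?F\<close> span_frame by blast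
    then show "representation B (deriv_f1 p b) b = - representation B (- deriv_f1 p b) b"
      using representation_neg[OF B(1)] by simp
  qed
  also have "\<dots> = mean_curvature A V1 h E M f1 p"
    unfolding mean_curvature_def trace_on_def Let_def B_def[symmetric]
    using W by simp
  finally show ?thesis ..
qed

end

section \<open>Left-invariant frames\<close>

text \<open>Left translation by \<open>mul q (iv p)\<close> carries \<open>p\<close> to
  \<open>q\<close>, and the pushforward of 0 is 0. This turns independence of invariant fields into
  independence of their values at each point.\<close>

lemma lie_algebra_vanish:
  assumes X: "X \<in> lie_algebra A mul" and G: "group mul e iv" and p: "X p = 0"
  shows "X = 0"
proof
  fix q
  interpret group mul e iv by (rule G)
  have "mul (mul q (iv p)) p = q" by (simp add: assoc)
  then have "X q = pushforward A (mul (mul q (iv p))) p (X p)"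
    using X unfolding lie_algebra_def by (metis (mono_tags, lifting) mem_Collect_eq)
  then show "X q = 0 q" using p by (auto simp: pushforward_def fun_eq_iff)
qed

section \<open>The metric in an orthonormal frame\<close>

lemma metric_sum:
  assumes h: "left_invariant_metric A mul V1 h"
    and u: "finite I" "\<And>i. i \<in> I \<Longrightarrow> u i \<in> distribution V1 p" and w: "w \<in> distribution V1 p"
  shows "h p (\<Sum>i\<in>I. a i *\<^sub>R u i) w = (\<Sum>i\<in>I. a i * h p (u i) w)"
  using u
proof (induction I rule: finite_induct)
  case empty
  \<comment> \<open>The value at the zero vector comes from homogeneity with scalar 0.\<close>
  have "h p (0 *\<^sub>R w) w = 0 * h p w w"
    using h w unfolding left_invariant_metric_def by blast
  then show ?case by (simp add: zero_fun_def)
next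
  case (insert i I)
  have "a i *\<^sub>R u i \<in> distribution V1 p" "(\<Sum>i\<in>I. a i *\<^sub>R u i) \<in> distribution V1 p"
    using insert.prems unfolding distribution_def by (auto intro: span_scale span_sum)
  then have "h p (a i *\<^sub>R u i + (\<Sum>i\<in>I. a i *\<^sub>R u i)) w = h p (a i *\<^sub>R u i) w + h p (\<Sum>i\<in>I. a i *\<^sub>R u i) w"
    using h w unfolding left_invariant_metric_def by blast
  moreover have "h p (a i *\<^sub>R u i) w = a i * h p (u i) w"
    using h w insert.prems unfolding left_invariant_metric_def by blast
  ultimately show ?case using insert by (simp only: sum.insert insertCI insert_iff simp_thms)
qed

lemma metric_orthonormal:
  assumes h: "left_invariant_metric A mul V1 h" and I: "finite I"
    and u: "\<And>i. i \<in> I \<Longrightarrow> u i \<in> distribution V1 p"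
    and on: "\<And>i j. i \<in> I \<Longrightarrow> j \<in> I \<Longrightarrow> h p (u i) (u j) = (if i = j then 1 else 0)"
  shows "h p (\<Sum>i\<in>I. a i *\<^sub>R u i) (\<Sum>i\<in>I. b i *\<^sub>R u i) = (\<Sum>i\<in>I. a i * b i)"
proof -
  have w: "(\<Sum>i\<in>I. b i *\<^sub>R u i) \<in> distribution V1 p"
    using u unfolding distribution_def by (auto intro: span_scale span_sum)
  have "h p (u i) (\<Sum>i\<in>I. b i *\<^sub>R u i) = b i" if i: "i \<in> I" for i
  proof -
    \<comment> \<open>Linearity is available in the first argument; symmetry carries it to the
      second.\<close>
    have "h p (u i) (\<Sum>i\<in>I. b i *\<^sub>R u i) = h p (\<Sum>i\<in>I. b i *\<^sub>R u i) (u i)"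
      using h w u[OF i] unfolding left_invariant_metric_def by blast
    also have "\<dots> = (\<Sum>j\<in>I. b j * h p (u j) (u i))"
      using metric_sum[OF h I u u[OF i]] .
    also have "\<dots> = (\<Sum>j\<in>I. if j = i then b j else 0)"
      using on i by (intro sum.cong) auto
    finally show ?thesis using I i by simp
  qed
  then show ?thesis using metric_sum[OF h I u w] by simp
qed

text \<open>The Weingarten operator and the mean curvature each carry a minus sign and the two
  cancel, so the identity reads H = div. The formula displayed with -H has the opposite sign: for
  the unit sphere in an abelian group of dimension n with its outer normal, both H and the
  divergence equal n - 1.\<close>

theorem proposition7:
  fixes A :: "('g::{t2_space,second_countable_topology}, 'e::euclidean_space) chart set"
    and mul :: "'g \<Rightarrow> 'g \<Rightarrow> 'g" and e :: 'g and iv :: "'g \<Rightarrow> 'g"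
    and r :: nat and V :: "nat \<Rightarrow> 'g vfield set"
    and h :: "'g \<Rightarrow> 'g tvec \<Rightarrow> 'g tvec \<Rightarrow> real"
    and E :: "nat \<Rightarrow> 'g vfield"
    and \<phi> :: "'g \<Rightarrow> real" and M :: "'g set" and f1 :: "'g vfield"
  assumes "sub_riemannian_stratified_group A mul e iv r V h"
    and "adapted_basis A mul r V h E"
    and "smooth_fun_on A UNIV \<phi>"
    and "M = {x. \<phi> x = 0 \<and> hgrad (dim (V 1)) E \<phi> x \<noteq> 0}"
    and "f1 = (\<lambda>x. (1 / norm_hgrad (dim (V 1)) E \<phi> x) *\<^sub>R hgrad (dim (V 1)) E \<phi> x)"
  shows "hypersurface A M \<and> non_horizontal A (V 1) M \<and>
    (\<forall>x\<in>M. mean_curvature A (V 1) h E M f1 x = divergence A E f1 x)"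
proof -
  let ?n = "DIM('e)" and ?d = "dim (V 1)"
  have lg: "smooth_atlas A" "group mul e iv" and r: "1 \<in> {1..r}"
    and metric: "left_invariant_metric A mul (V 1) h"
    and V1: "V 1 \<subseteq> lie_algebra A mul"
    using assms(1)
    unfolding sub_riemannian_stratified_group_def stratified_group_def lie_group_def stratification_def
    by auto
  have basis: "inj_on E {1..?n}" "independent (E ` {1..?n})" "span (E ` {1..?n}) = lie_algebra A mul"
    and strata: "\<forall>j\<in>{1..r}. span (E ` {(\<Sum>i=1..<j. dim (V i))<..(\<Sum>i=1..j. dim (V i))}) = V j"
    and on: "\<And>p i k. i \<in> {1..?d} \<Longrightarrow> k \<in> {1..?d} \<Longrightarrow> h p (E i p) (E k p) = (if i = k then 1 else 0)"
    using assms(2) unfolding adapted_basis_def by auto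
  \<comment> \<open>For the first stratum the lower bound of the index range is an empty sum, that
    is 0.\<close>
  have "{0<..?d} = {1..?d}" by auto
  then have spanV1: "span (E ` {1..?d}) = V 1"
    using bspec[OF strata r] by simp
  \<comment> \<open>Evaluation at \<open>p\<close> is linear and so commutes with
    \<open>span\<close>; the values of \<open>V 1\<close> already form a subspace.\<close>
  have "(\<lambda>X. X p) ` V 1 = span ((\<lambda>i. E i p) ` {1..?d})" for p
    using linear_span_image[OF linear_eval[of p], of "E ` {1..?d}"] by (simp only: spanV1 image_image)
  then have dist: "distribution (V 1) p = span ((\<lambda>i. E i p) ` {1..?d})" for p
    unfolding distribution_def by (simp add: Setcompr_eq_image span_span)
  interpret horizontal_frame A E ?d "V 1" h \<phi>
  proof
    show "smooth_vfield A (E k)" if "k \<in> {1..?n}" for k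
      using that basis(3) span_base[of "E k" "E ` {1..?n}"] unfolding lie_algebra_def by blast
    show "\<forall>k\<in>{1..?n}. c k = 0" if 0: "(\<Sum>k=1..?n. c k *\<^sub>R E k p) = 0" for c p
    proof -
      \<comment> \<open>With constant coefficients the combination is again left-invariant;
        vanishing at \<open>p\<close>, it vanishes everywhere, and independence of the fields
        applies.\<close>
      have "(\<Sum>k=1..?n. c k *\<^sub>R E k) \<in> lie_algebra A mul"
        unfolding basis(3)[symmetric] by (intro span_sum span_scale span_base) auto
      moreover have "(\<Sum>k=1..?n. c k *\<^sub>R E k) p = 0"
        using 0 by (simp add: fun_sum_apply)
      ultimately have "(\<Sum>k=1..?n. c k *\<^sub>R E k) = (\<Sum>k=1..?n. 0 *\<^sub>R E k)"
        using lie_algebra_vanish[OF _ lg(2)] by simp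
      then show ?thesis
        using inj_on_independent_sum_eq[OF basis(1,2), of _ c "\<lambda>_. 0"] by simp
    qed
    show "?d \<le> ?n"
      using dim_le_card[of "V 1" "E ` {1..?n}"] V1 basis(3) card_image[OF basis(1)] by simp
    show "h p (\<Sum>i=1..?d. a i *\<^sub>R E i p) (\<Sum>i=1..?d. b i *\<^sub>R E i p) = (\<Sum>i=1..?d. a i * b i)" for p a b
      by (rule metric_orthonormal[OF metric]) (use on dist in \<open>auto intro: span_base\<close>)
  qed (use lg dist assms(3) in auto)
  have "f1 = local.f1" unfolding assms(5) f1_def[abs_def] ..
  then show ?thesis
    using hypersurface_M non_horizontal_M mean_curvature_M assms(4) by simp
qed

end
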